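(* The Banach algebra $W(J^* )$ has a B.L.A.I. (bounded left approximate identity), where $J^*$ is the dual of James' space $J$.
   Context: For a Banach space $E$, $W(E)$ denotes the Banach algebra of weakly compact operators $E\to E$ with the operator norm. A Banach algebra $A$ has a bounded left approximate identity (B.L.A.I.) if there is a bounded net $(x_\alpha)\subset A$ such that $\lim_\alpha\|y-x_\alpha y\|=0$ for all $y\in A$. James' space $J$ is the Banach space of real sequences $x=(x_j)_{j\ge1}$ with $\lim_j x_j=0$ and $\|x\|^2=\sup\sum_{j=1}^n|x_{p_{j+1}}-x_{p_j}|^2<\infty$, where the supremum is over all $n\in\mathbb N$ and $1\le p_1<\dots<p_n<p_{n+1}$. *)

theory Defs
  imports "HOL-Analysis.Analysis"
begin

section \<open>James' space\<close>

text \<open>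
  Sequences are indexed from 0 rather than from 1, so position \<open>j\<close> here is position \<open>j + 1\<close> in the
  usual notation. The indices \<open>p 0 < \<dots> < p n\<close> play the role of \<open>p\<^sub>1 < \<dots> < p\<^sub>n\<^sub>+\<^sub>1\<close>; the
  values of \<open>p\<close> beyond \<open>n\<close> are irrelevant. The case \<open>n = 0\<close> only contributes the value 0.
\<close>

definition james_variations :: "(nat \<Rightarrow> real) \<Rightarrow> real set" where
  "james_variations x =
     {\<Sum>j<n. (x (p (Suc j)) - x (p j))\<^sup>2 | n p. strict_mono_on {..n} (p :: nat \<Rightarrow> nat)}"

definition james_norm :: "(nat \<Rightarrow> real) \<Rightarrow> real" where
  "james_norm x = sqrt (Sup (james_variations x))"

definition james_seqs :: "(nat \<Rightarrow> real) set" where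
  "james_seqs = {x. x \<longlonglongrightarrow> 0 \<and> bdd_above (james_variations x)}"

lemma james_variations_iff_L2:
  "bdd_above (james_variations x) \<and> Sup (james_variations x) \<le> c\<^sup>2 \<longleftrightarrow>
     (\<forall>n p. strict_mono_on {..n} (p :: nat \<Rightarrow> nat) \<longrightarrow>
        L2_set (\<lambda>j. x (p (Suc j)) - x (p j)) {..<n} \<le> c)"
  if c: "c \<ge> 0"
proof -
  have ne: "james_variations x \<noteq> {}"
    unfolding james_variations_def by (auto intro!: exI[of _ "0::nat"] exI[of _ "id::nat\<Rightarrow>nat"] simp: strict_mono_on_def)
  have "bdd_above (james_variations x) \<and> Sup (james_variations x) \<le> c\<^sup>2 \<longleftrightarrow> (\<forall>v\<in>james_variations x. v \<le> c\<^sup>2)"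
    using ne by (meson bdd_above.I cSup_least cSup_upper order_trans)
  also have "\<dots> \<longleftrightarrow> (\<forall>n p. strict_mono_on {..n} (p :: nat \<Rightarrow> nat) \<longrightarrow>
        (\<Sum>j<n. (x (p (Suc j)) - x (p j))\<^sup>2) \<le> c\<^sup>2)"
    unfolding james_variations_def by blast
  also have "\<dots> \<longleftrightarrow> (\<forall>n p. strict_mono_on {..n} (p :: nat \<Rightarrow> nat) \<longrightarrow>
        L2_set (\<lambda>j. x (p (Suc j)) - x (p j)) {..<n} \<le> c)"
    unfolding L2_set_def real_sqrt_le_iff'[OF sum_nonneg[OF zero_le_power2] c] ..
  finally show ?thesis .
qed

lemma james_Sup_nonneg:
  assumes "bdd_above (james_variations x)"
  shows "0 \<le> Sup (james_variations x)"
proof (rule cSup_upper[OF _ assms])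
  show "0 \<in> james_variations x"
    unfolding james_variations_def
    by (auto intro!: exI[of _ "0::nat"] exI[of _ "id::nat\<Rightarrow>nat"] simp: strict_mono_on_def)
qed

lemma james_norm_nonneg: "bdd_above (james_variations x) \<Longrightarrow> 0 \<le> james_norm x"
  by (simp add: james_norm_def james_Sup_nonneg)

lemma james_L2_le:
  assumes "bdd_above (james_variations x)" "strict_mono_on {..n} (p :: nat \<Rightarrow> nat)"
  shows "L2_set (\<lambda>j. x (p (Suc j)) - x (p j)) {..<n} \<le> james_norm x"
  using james_variations_iff_L2[of "james_norm x" x] james_norm_nonneg[OF assms(1)]
    james_Sup_nonneg[OF assms(1)] assms
  by (simp add: james_norm_def)

lemma james_leI:
  assumes "c \<ge> 0"
    "\<And>n p. strict_mono_on {..n} (p :: nat \<Rightarrow> nat) \<Longrightarrow>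
       L2_set (\<lambda>j. x (p (Suc j)) - x (p j)) {..<n} \<le> c"
  shows "bdd_above (james_variations x)" "james_norm x \<le> c"
  using james_variations_iff_L2[of c x] assms
  by (auto simp: james_norm_def intro!: real_le_lsqrt)

lemma james_add:
  assumes x: "bdd_above (james_variations x)" and y: "bdd_above (james_variations y)"
  shows "bdd_above (james_variations (\<lambda>i. x i + y i))"
    "james_norm (\<lambda>i. x i + y i) \<le> james_norm x + james_norm y"
proof -
  have "L2_set (\<lambda>j. (x (p (Suc j)) + y (p (Suc j))) - (x (p j) + y (p j))) {..<n}
      \<le> james_norm x + james_norm y" if "strict_mono_on {..n} p" for n and p :: "nat \<Rightarrow> nat"
    using L2_set_triangle_ineq[of "\<lambda>j. x (p (Suc j)) - x (p j)" "\<lambda>j. y (p (Suc j)) - y (p j)" "{..<n}"]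
      james_L2_le[OF x that] james_L2_le[OF y that] by (simp add: algebra_simps)
  then show "bdd_above (james_variations (\<lambda>i. x i + y i))"
    "james_norm (\<lambda>i. x i + y i) \<le> james_norm x + james_norm y"
    using james_leI[of "james_norm x + james_norm y" "\<lambda>i. x i + y i"] james_norm_nonneg[OF x] james_norm_nonneg[OF y]
    by auto
qed

lemma james_scale:
  assumes x: "bdd_above (james_variations x)"
  shows "bdd_above (james_variations (\<lambda>i. r * x i))"
    "james_norm (\<lambda>i. r * x i) \<le> \<bar>r\<bar> * james_norm x"
proof -
  have "L2_set (\<lambda>j. r * x (p (Suc j)) - r * x (p j)) {..<n}
      \<le> \<bar>r\<bar> * james_norm x" if "strict_mono_on {..n} p" for n and p :: "nat \<Rightarrow> nat"
  proof -
    have "L2_set (\<lambda>j. r * x (p (Suc j)) - r * x (p j)) {..<n}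
        = \<bar>r\<bar> * L2_set (\<lambda>j. x (p (Suc j)) - x (p j)) {..<n}"
      by (simp add: L2_set_def power_mult_distrib real_sqrt_mult flip: sum_distrib_left right_diff_distrib)
    then show ?thesis
      using james_L2_le[OF x that] by (simp add: mult_left_mono)
  qed
  then show "bdd_above (james_variations (\<lambda>i. r * x i))"
    "james_norm (\<lambda>i. r * x i) \<le> \<bar>r\<bar> * james_norm x"
    using james_leI[of "\<bar>r\<bar> * james_norm x" "\<lambda>i. r * x i"] james_norm_nonneg[OF x]
    by auto
qed

lemma james_scale_eq:
  assumes x: "bdd_above (james_variations x)"
  shows "james_norm (\<lambda>i. r * x i) = \<bar>r\<bar> * james_norm x"
proof (cases "r = 0")
  case True
  then show ?thesis
    using james_scale(2)[OF x, of r] james_norm_nonneg[OF james_scale(1)[OF x, of r]] by auto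
next
  case False
  then have "james_norm x \<le> \<bar>inverse r\<bar> * james_norm (\<lambda>i. r * x i)"
    using james_scale(2)[OF james_scale(1)[OF x, of r], of "inverse r"]
    by (simp flip: mult.assoc)
  then have "\<bar>r\<bar> * james_norm x \<le> james_norm (\<lambda>i. r * x i)"
    using False by (simp add: field_simps)
  then show ?thesis
    using james_scale(2)[OF x, of r] by simp
qed

lemma james_diff_le:
  assumes x: "bdd_above (james_variations x)" and "i < k"
  shows "\<bar>x k - x i\<bar> \<le> james_norm x"
  using james_L2_le[OF x, of 1 "\<lambda>j. if j = 0 then i else k"] \<open>i < k\<close>
  by (simp add: strict_mono_on_def L2_set_def)

lemma james_zero: "james_norm (\<lambda>_. 0) = 0" "bdd_above (james_variations (\<lambda>_. 0))"
  using james_leI[of 0 "\<lambda>_. 0"] james_norm_nonneg[of "\<lambda>_. 0"] by (auto simp: L2_set_def)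

lemma james_norm_eq_0:
  assumes x: "x \<in> james_seqs" and "james_norm x = 0"
  shows "x = (\<lambda>_. 0)"
proof -
  have eq: "x i = x 0" for i
    using james_diff_le[of x 0 i] assms by (cases "i = 0") (auto simp: james_seqs_def)
  then have "x \<longlonglongrightarrow> x 0"
    by (metis ext tendsto_const)
  then have "x 0 = 0"
    using x LIMSEQ_unique by (auto simp: james_seqs_def)
  with eq show ?thesis by auto
qed

typedef james = james_seqs
  morphisms james_seq Abs_james
  by (auto simp: james_seqs_def james_zero intro!: exI[of _ "\<lambda>_. 0"])

setup_lifting type_definition_james

instantiation james :: real_normed_vector
begin

lift_definition norm_james :: "james \<Rightarrow> real" is james_norm .

lift_definition zero_james :: james is "\<lambda>_. 0"
  by (simp add: james_seqs_def james_zero)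

lift_definition plus_james :: "james \<Rightarrow> james \<Rightarrow> james" is "\<lambda>x y i. x i + y i"
  using tendsto_add james_add by (fastforce simp: james_seqs_def)

lift_definition scaleR_james :: "real \<Rightarrow> james \<Rightarrow> james" is "\<lambda>r x i. r * x i"
  using tendsto_mult_right_zero james_scale by (fastforce simp: james_seqs_def)

definition uminus_james :: "james \<Rightarrow> james" where
  "uminus_james x = (-1) *\<^sub>R x"

definition minus_james :: "james \<Rightarrow> james \<Rightarrow> james" where
  "minus_james x y = x + - y"

definition dist_james :: "james \<Rightarrow> james \<Rightarrow> real" where
  "dist_james x y = norm (x - y)"

definition sgn_james :: "james \<Rightarrow> james" where
  "sgn_james x = inverse (norm x) *\<^sub>R x"

definition uniformity_james :: "(james \<times> james) filter" where
  "uniformity_james = (INF e\<in>{0<..}. principal {(x, y). dist x y < e})"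

definition open_james :: "james set \<Rightarrow> bool" where
  "open_james U = (\<forall>x\<in>U. \<forall>\<^sub>F (x', y) in uniformity. x' = x \<longrightarrow> y \<in> U)"

instance
proof
  fix x y z :: james and a b :: real
  show "x + y + z = x + (y + z)" by transfer (simp add: add.assoc)
  show "x + y = y + x" by transfer (simp add: add.commute)
  show "0 + x = x" by transfer simp
  show "- x + x = 0" unfolding uminus_james_def by transfer simp
  show "x - y = x + - y" by (rule minus_james_def)
  show "a *\<^sub>R (x + y) = a *\<^sub>R x + a *\<^sub>R y" by transfer (simp add: algebra_simps)
  show "(a + b) *\<^sub>R x = a *\<^sub>R x + b *\<^sub>R x" by transfer (simp add: algebra_simps)
  show "a *\<^sub>R b *\<^sub>R x = (a * b) *\<^sub>R x" by transfer (simp add: algebra_simps)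
  show "1 *\<^sub>R x = x" by transfer simp
  show "norm x = 0 \<longleftrightarrow> x = 0"
    by transfer (use james_norm_eq_0 james_zero in blast)
  show "norm (x + y) \<le> norm x + norm y" by transfer (simp add: james_seqs_def james_add)
  show "norm (a *\<^sub>R x) = \<bar>a\<bar> * norm x" by transfer (simp add: james_seqs_def james_scale_eq)
qed (simp_all add: dist_james_def sgn_james_def uniformity_james_def open_james_def)

end


section \<open>Weakly compact operators\<close>

text \<open>
  The weak topology is the initial topology for all bounded functionals: the function space
  carries the product topology, i.e. pointwise convergence.
\<close>

definition weak_topology :: "'e::real_normed_vector topology" where
  "weak_topology = pullback_topology UNIV (\<lambda>x. \<lambda>f :: 'e \<Rightarrow>\<^sub>L real. blinfun_apply f x) euclidean"

definition weakly_compact_operators :: "('e::banach \<Rightarrow>\<^sub>L 'e) set" where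
  "weakly_compact_operators =
     {T. compactin weak_topology (weak_topology closure_of (blinfun_apply T ` cball 0 1))}"


section \<open>Bounded left approximate identities\<close>

text \<open>
  Nets are indexed by nonempty directed preordered sets. The carrier \<open>A\<close> is a set of elements of a
  normed space, with the multiplication given explicitly, since bounded operators under composition
  do not form an instance of the normed-algebra type classes.
\<close>

definition is_blai ::
    "('a::real_normed_vector \<Rightarrow> 'a \<Rightarrow> 'a) \<Rightarrow> 'a set \<Rightarrow> 'i set \<Rightarrow> 'i rel \<Rightarrow> ('i \<Rightarrow> 'a) \<Rightarrow> bool" where
  "is_blai mul A I r x \<longleftrightarrow>
     I \<noteq> {} \<and> preorder_on I r \<and> (\<forall>i\<in>I. \<forall>j\<in>I. \<exists>k\<in>I. (i, k) \<in> r \<and> (j, k) \<in> r) \<and>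
     x ` I \<subseteq> A \<and> bounded (x ` I) \<and>
     (\<forall>y\<in>A. \<forall>\<epsilon>>0. \<exists>i\<in>I. \<forall>k\<in>I. (i, k) \<in> r \<longrightarrow> norm (y - mul (x k) y) < \<epsilon>)"

text \<open>
  One cannot quantify existentially over the type of the index set. The type chosen here is no
  restriction: by \<open>has_blaiI\<close> a net over an index set of any type will do.
\<close>

definition has_blai :: "('a::real_normed_vector \<Rightarrow> 'a \<Rightarrow> 'a) \<Rightarrow> 'a set \<Rightarrow> bool" where
  "has_blai mul A \<longleftrightarrow> (\<exists>(I :: ('a set \<times> nat) set) r x. is_blai mul A I r x)"

lemma has_blaiI:
  fixes I :: "'i set"
  assumes "is_blai mul A I r x"
  shows "has_blai mul A"
proof -
  note a = assms[unfolded is_blai_def]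
  have fin: "\<exists>i\<in>I. \<forall>k\<in>I. (i, k) \<in> r \<longrightarrow> (\<forall>y\<in>F. norm (y - mul (x k) y) < e)"
    if "finite F" "F \<subseteq> A" "e > 0" for F and e :: real
    using that
  proof (induction F)
    case empty
    then show ?case using a by auto
  next
    case (insert y F)
    have "\<exists>j\<in>I. \<forall>k\<in>I. (j, k) \<in> r \<longrightarrow> norm (y - mul (x k) y) < e"
      using a insert.prems by blast
    moreover have "\<exists>i\<in>I. \<forall>k\<in>I. (i, k) \<in> r \<longrightarrow> (\<forall>y\<in>F. norm (y - mul (x k) y) < e)"
      using insert by blast
    ultimately obtain i j where ij: "i \<in> I" "j \<in> I"
      "\<And>k. k \<in> I \<Longrightarrow> (i, k) \<in> r \<Longrightarrow> \<forall>y\<in>F. norm (y - mul (x k) y) < e"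
      "\<And>k. k \<in> I \<Longrightarrow> (j, k) \<in> r \<Longrightarrow> norm (y - mul (x k) y) < e"
      by blast
    obtain l where l: "l \<in> I" "(i, l) \<in> r" "(j, l) \<in> r"
      using a ij(1,2) by blast
    have "trans r" using a by (simp add: preorder_on_def)
    then show ?case
      using ij l by (intro bexI[of _ l]) (metis insertE transD, simp)
  qed
  have "\<exists>i. i \<in> I \<and> (\<forall>y\<in>fst q. norm (y - mul (x i) y) < inverse (real (Suc (snd q))))"
    if q: "finite (fst q)" "fst q \<subseteq> A" for q :: "'a set \<times> nat"
  proof -
    obtain i where i: "i \<in> I" "\<forall>k\<in>I. (i, k) \<in> r \<longrightarrow>
        (\<forall>y\<in>fst q. norm (y - mul (x k) y) < inverse (real (Suc (snd q))))"
      using fin[OF q, of "inverse (real (Suc (snd q)))"] by auto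
    moreover have "(i, i) \<in> r"
      using a i(1) by (simp add: preorder_on_def refl_on_def)
    ultimately show ?thesis by blast
  qed
  then obtain g where g: "\<And>q :: 'a set \<times> nat. finite (fst q) \<Longrightarrow> fst q \<subseteq> A \<Longrightarrow> g q \<in> I \<and>
      (\<forall>y\<in>fst q. norm (y - mul (x (g q)) y) < inverse (real (Suc (snd q))))"
    by metis
  define I' where "I' = {F. finite F \<and> F \<subseteq> A} \<times> (UNIV :: nat set)"
  define r' where "r' = {(p, q). p \<in> I' \<and> q \<in> I' \<and> fst p \<subseteq> fst q \<and> snd p \<le> snd q}"
  have "is_blai mul A I' r' (\<lambda>q. x (g q))"
    unfolding is_blai_def
  proof (intro conjI ballI allI impI)
    show "I' \<noteq> {}" by (auto simp: I'_def)
    show "preorder_on I' r'"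
      unfolding preorder_on_def r'_def refl_on_def trans_def by auto
    show "\<exists>k\<in>I'. (i, k) \<in> r' \<and> (j, k) \<in> r'" if "i \<in> I'" "j \<in> I'" for i j
      using that
      by (intro bexI[of _ "(fst i \<union> fst j, max (snd i) (snd j))"]) (auto simp: r'_def I'_def)
    have *: "(\<lambda>q. x (g q)) ` I' \<subseteq> x ` I"
      using g by (auto simp: I'_def)
    have "x ` I \<subseteq> A" "bounded (x ` I)" using a by simp_all
    then show "(\<lambda>q. x (g q)) ` I' \<subseteq> A" "bounded ((\<lambda>q. x (g q)) ` I')"
      using * by (simp_all only: order_trans[OF *] bounded_subset[OF _ *])
    show "\<exists>i\<in>I'. \<forall>k\<in>I'. (i, k) \<in> r' \<longrightarrow> norm (y - mul (x (g k)) y) < \<epsilon>"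
      if yA: "y \<in> A" and pos: "\<epsilon> > 0" for y and \<epsilon> :: real
    proof -
      obtain n where n: "inverse (real (Suc n)) < \<epsilon>"
        using reals_Archimedean[OF pos] by blast
      show ?thesis
      proof (intro bexI[of _ "({y}, n)"] ballI impI)
        show "({y}, n) \<in> I'" using yA by (simp add: I'_def)
        fix k assume k: "k \<in> I'" "(({y}, n), k) \<in> r'"
        then have "norm (y - mul (x (g k)) y) < inverse (real (Suc (snd k)))"
          using g[of k] by (auto simp: I'_def r'_def)
        also have "\<dots> \<le> inverse (real (Suc n))"
          using k by (auto simp: r'_def intro!: le_imp_inverse_le)
        finally show "norm (y - mul (x (g k)) y) < \<epsilon>" using n by simp
      qed
    qed
  qed
  then show ?thesis unfolding has_blai_def by blast
qed

end

theory Submission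
  imports Defs
begin

text \<open>
  Let \<open>s\<^sub>n\<close> be the indicator sequence of \<open>{0..<n}\<close>. The unit vectors form a shrinking basis of \<open>J\<close>, so
  \<open>f (s\<^sub>n)\<close> converges for every functional \<open>f\<close>, to \<open>L f\<close>, say. If \<open>T\<close> is weakly compact on \<open>J\<^sup>*\<close>, a minimax
  argument yields far out convex combinations \<open>t\<close> of the \<open>s\<^sub>n\<close> with \<open>f t\<close> close to \<open>L f\<close> uniformly for
  \<open>f\<close> in the image of the unit ball. Choose successive such \<open>t\<^sub>i\<close>, descending from 1 to 0 between nodes
  \<open>k\<^sub>i\<close> and \<open>k\<^sub>i\<^sub>+\<^sub>1\<close>, with errors \<open>\<epsilon>\<^sub>i\<close> of small sum. The operator
  \<open>W x = (\<Sum>i\<ge>1. x (k\<^sub>i) (t\<^sub>i - t\<^sub>i\<^sub>-\<^sub>1))\<close> on \<open>J\<close> is a monotone interpolation between the nodes, up to a term of rank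
  one, hence of norm at most 2, and \<open>f \<circ> W\<close> is uniformly small for \<open>f\<close> in the image of \<open>T\<close>. Since
  \<open>U = id - W\<close> maps into the sequences vanishing at the nodes \<open>k\<^sub>i\<close> with \<open>i \<ge> 1\<close>, its biadjoint maps
  \<open>J\<^sup>*\<^sup>*\<close> into \<open>J\<close>. Therefore the adjoint of \<open>U\<close> is weakly compact; it is the required approximate left unit.
\<close>

section \<open>Square variations along lists\<close>

text \<open>Lists take the place of index functions because they can be cut and concatenated. The
  truncated subtraction makes the empty list contribute 0.\<close>

definition sq_var :: "(nat \<Rightarrow> real) \<Rightarrow> nat list \<Rightarrow> real" where
  "sq_var x l = (\<Sum>j<length l - 1. (x (l ! Suc j) - x (l ! j))\<^sup>2)"

lemma sq_var_simps [simp]: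
  "sq_var x [] = 0"
  "sq_var x [a] = 0"
  "sq_var x (a # b # l) = (x b - x a)\<^sup>2 + sq_var x (b # l)"
  by (simp_all add: sq_var_def sum.lessThan_Suc_shift del: sum.lessThan_Suc)

lemma sq_var_cong: "(\<And>n. n \<in> set l \<Longrightarrow> x n = y n) \<Longrightarrow> sq_var x l = sq_var y l"
  by (auto simp: sq_var_def intro!: sum.cong)

lemma sq_var_append:
  "l \<noteq> [] \<Longrightarrow> l' \<noteq> [] \<Longrightarrow>
     sq_var x (l @ l') = sq_var x l + (x (hd l') - x (last l))\<^sup>2 + sq_var x l'"
proof (induction l)
  case (Cons a l)
  then show ?case
    by (cases l; cases l') auto
qed simp

lemma sq_var_append_ge: "sq_var x l + sq_var x l' \<le> sq_var x (l @ l')"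
  using sq_var_append[of l l' x] by (cases "l = []"; cases "l' = []") auto

lemma sq_var_remdups_adj: "sq_var x (remdups_adj l) = sq_var x l"
proof (induction l rule: remdups_adj.induct)
  case (3 a b l)
  then show ?case
    by (cases "remdups_adj (b # l)") (auto, metis hd_remdups_adj list.sel(1))
qed auto

lemma sorted_remdups_adj_strict: "sorted l \<Longrightarrow> sorted_wrt (<) (remdups_adj (l :: nat list))"
proof (induction l rule: remdups_adj.induct)
  case (3 a b l)
  then show ?case by fastforce
qed auto

lemma sq_var_map_upt:
  "sq_var x (map p [0..<Suc n]) = (\<Sum>j<n. (x (p (Suc j)) - x (p j))\<^sup>2)"
  unfolding sq_var_def by (auto intro!: sum.cong simp del: upt_Suc)

lemma james_variations_eq: "james_variations x = sq_var x ` {l. sorted l}"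
proof (intro equalityI subsetI)
  fix v assume "v \<in> james_variations x"
  then obtain n p where p: "strict_mono_on {..n} (p :: nat \<Rightarrow> nat)"
    and v: "v = (\<Sum>j<n. (x (p (Suc j)) - x (p j))\<^sup>2)"
    by (auto simp: james_variations_def)
  have "sorted (map p [0..<Suc n])"
    using strict_mono_on_leD[OF p] unfolding sorted_iff_nth_mono
    by (auto simp del: upt_Suc)
  moreover have "v = sq_var x (map p [0..<Suc n])"
    unfolding v by (rule sq_var_map_upt[symmetric])
  ultimately show "v \<in> sq_var x ` {l. sorted l}" by blast
next
  fix v assume "v \<in> sq_var x ` {l. sorted l}"
  then obtain l where l: "sorted_wrt (<) l" and v: "v = sq_var x l"
    using sorted_remdups_adj_strict sq_var_remdups_adj by (metis imageE mem_Collect_eq)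
  show "v \<in> james_variations x"
  proof (cases "l = []")
    case True
    then show ?thesis
      using v unfolding james_variations_def
      by (auto intro!: exI[of _ "0::nat"] exI[of _ "id::nat\<Rightarrow>nat"] simp: strict_mono_on_def)
  next
    case False
    have "strict_mono_on {..length l - 1} (\<lambda>j. l ! j)"
      using l False unfolding strict_mono_on_def
      by (metis One_nat_def Suc_pred atMost_iff le_imp_less_Suc length_greater_0_conv sorted_wrt_nth_less)
    then show ?thesis
      using v unfolding james_variations_def sq_var_def by blast
  qed
qed

lemma sq_var_le_norm:
  assumes "bdd_above (james_variations x)" "sorted l"
  shows "sq_var x l \<le> (james_norm x)\<^sup>2"
  using assms cSup_upper[of "sq_var x l" "james_variations x"] james_Sup_nonneg[OF assms(1)]
  by (auto simp: james_norm_def james_variations_eq)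

lemma james_norm_le_sq_varI:
  assumes "\<And>l. sorted l \<Longrightarrow> sq_var x l \<le> c\<^sup>2" "0 \<le> c"
  shows "bdd_above (james_variations x)" "james_norm x \<le> c"
proof -
  show b: "bdd_above (james_variations x)"
    using assms by (auto simp: james_variations_eq bdd_above_def)
  have "Sup (james_variations x) \<le> c\<^sup>2"
    using assms by (auto simp: james_variations_eq intro!: cSup_least exI[of _ "[]"])
  then show "james_norm x \<le> c"
    using assms(2) by (simp add: james_norm_def real_le_lsqrt)
qed

text \<open>A list whose variation is within \<delta> of the supremum leaves at most \<delta> for
  any list placed behind it.\<close>

lemma sq_var_tail_small:
  assumes b: "bdd_above (james_variations x)" and "\<delta> > 0"
  shows "\<exists>N. \<forall>l. sorted l \<longrightarrow> set l \<subseteq> {N..} \<longrightarrow> sq_var x l \<le> \<delta>"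
proof -
  have "\<exists>v\<in>james_variations x. Sup (james_variations x) - \<delta> < v"
    using less_cSup_iff[of "james_variations x" "Sup (james_variations x) - \<delta>"] b \<open>\<delta> > 0\<close>
    by (auto simp: james_variations_eq intro: exI[of _ "[]"])
  then obtain l0 where l0: "sorted l0" "Sup (james_variations x) - \<delta> < sq_var x l0"
    by (auto simp: james_variations_eq)
  show ?thesis
  proof (intro exI[of _ "Max (insert 0 (set l0))"] allI impI)
    fix l assume l: "sorted l" "set l \<subseteq> {Max (insert 0 (set l0))..}"
    have "sorted (l0 @ l)"
      using l l0(1) by (auto simp: sorted_append subset_eq)
    then have "sq_var x (l0 @ l) \<le> Sup (james_variations x)"
      using b by (auto simp: james_variations_eq intro!: cSup_upper)
    then show "sq_var x l \<le> \<delta>"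
      using sq_var_append_ge[of x l0 l] l0(2) by linarith
  qed
qed

lemma bdd_james_variations_convergent:
  assumes b: "bdd_above (james_variations x)"
  shows "convergent x"
proof (rule Cauchy_convergent, rule CauchyI)
  fix e :: real assume e: "e > 0"
  obtain N where N: "\<And>l. sorted l \<Longrightarrow> set l \<subseteq> {N..} \<Longrightarrow> sq_var x l \<le> (e/2)\<^sup>2"
    using sq_var_tail_small[OF b, of "(e/2)\<^sup>2"] e by auto
  have *: "\<bar>x n - x m\<bar> < e" if "N \<le> m" "m \<le> n" for m n
  proof -
    have "(x n - x m)\<^sup>2 \<le> (e/2)\<^sup>2"
      using N[of "[m, n]"] that by simp
    then have "\<bar>x n - x m\<bar> \<le> e/2"
      using e abs_le_square_iff[of "x n - x m" "e/2"] by simp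
    then show ?thesis using e by linarith
  qed
  show "\<exists>M. \<forall>m\<ge>M. \<forall>n\<ge>M. norm (x m - x n) < e"
    by (intro exI[of _ N] allI impI) (metis * abs_minus_commute nat_le_linear real_norm_def)
qed

text \<open>Bounded variation forces convergence, so a single subsequence decides the limit. This is
  how sequences controlled at the nodes are recognised as elements of \<open>J\<close>.\<close>

lemma james_seqsI_subseq:
  assumes b: "bdd_above (james_variations x)" and k: "strict_mono k"
    and lim: "(\<lambda>i. x (k i)) \<longlonglongrightarrow> 0"
  shows "x \<in> james_seqs"
proof -
  obtain c where c: "x \<longlonglongrightarrow> c"
    using bdd_james_variations_convergent[OF b] by (auto simp: convergent_def)
  then have "(\<lambda>i. x (k i)) \<longlonglongrightarrow> c"
    using LIMSEQ_subseq_LIMSEQ[OF c k] by (simp add: o_def)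
  then have "c = 0" using lim LIMSEQ_unique by blast
  then show ?thesis using b c by (simp add: james_seqs_def)
qed

lemma sorted_split:
  assumes "sorted l"
  shows "\<exists>l1 l2. l = l1 @ l2 \<and> (\<forall>n\<in>set l1. n < N) \<and> (\<forall>n\<in>set l2. N \<le> n)"
  using assms
proof (induction l)
  case (Cons a l)
  then obtain l1 l2 where l: "l = l1 @ l2" "\<forall>n\<in>set l1. n < N" "\<forall>n\<in>set l2. N \<le> n"
    by auto
  show ?case
  proof (cases "a < N")
    case True
    then show ?thesis
      using l by (intro exI[of _ "a # l1"] exI[of _ l2]) auto
  next
    case False
    then show ?thesis
      using Cons.prems by (intro exI[of _ "[]"] exI[of _ "a # l"]) auto
  qed
qed auto

text \<open>The cut creates just one new jump, from 0 to some \<open>x n\<close>, and its square is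
  again at most \<delta>; hence the factor 2.\<close>

lemma sq_var_tail:
  assumes lim: "x \<longlonglongrightarrow> 0" and d: "\<And>l. sorted l \<Longrightarrow> set l \<subseteq> {N..} \<Longrightarrow> sq_var x l \<le> \<delta>"
    and l: "sorted l"
  shows "sq_var (\<lambda>n. if n < N then 0 else x n) l \<le> 2 * \<delta>"
proof -
  let ?y = "\<lambda>n. if n < N then 0 else x n"
  obtain l1 l2 where l12: "l = l1 @ l2" "\<forall>n\<in>set l1. n < N" "\<forall>n\<in>set l2. N \<le> n"
    using sorted_split[OF l] by blast
  have d0: "0 \<le> \<delta>" using d[of "[]"] by simp
  have 1: "sq_var ?y l1 = 0"
    using l12(2) sq_var_cong[of l1 ?y "\<lambda>_. 0"] by (simp add: sq_var_def)
  have "sq_var ?y l2 = sq_var x l2"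
    using l12(3) by (intro sq_var_cong) (auto simp: not_less)
  moreover have "sq_var x l2 \<le> \<delta>"
    using l l12 by (intro d) (auto simp: sorted_append)
  ultimately have 2: "sq_var ?y l2 \<le> \<delta>" by simp
  \<comment> \<open>In the list \<open>[n, m]\<close> let \<open>m\<close> tend to infinity.\<close>
  have 3: "(x n)\<^sup>2 \<le> \<delta>" if "N \<le> n" for n
  proof (rule tendsto_upperbound[OF _ _ trivial_limit_sequentially])
    show "(\<lambda>m. (x m - x n)\<^sup>2) \<longlonglongrightarrow> (x n)\<^sup>2"
      using tendsto_power[OF tendsto_diff[OF lim tendsto_const[of "x n"]], of 2] by simp
    show "\<forall>\<^sub>F m in sequentially. (x m - x n)\<^sup>2 \<le> \<delta>"
      using eventually_ge_at_top[of n]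
    proof eventually_elim
      case (elim m)
      then show ?case using d[of "[n, m]"] that by simp
    qed
  qed
  show ?thesis
  proof (cases "l1 = [] \<or> l2 = []")
    case True
    then show ?thesis using 1 2 d0 l12(1) by auto
  next
    case False
    then have "last l1 < N" "N \<le> hd l2"
      using l12 by auto
    then show ?thesis
      using False sq_var_append[of l1 l2 ?y] 1 2 3[of "hd l2"] l12(1) by simp
  qed
qed

section \<open>Coordinates and tails in James' space\<close>

lemma bdd_james_seq [simp]: "bdd_above (james_variations (james_seq x))"
  and tendsto_james_seq: "james_seq x \<longlonglongrightarrow> 0"
  using james_seq[of x] by (auto simp: james_seqs_def)

lemma sq_var_james_le: "sorted l \<Longrightarrow> sq_var (james_seq x) l \<le> (norm x)\<^sup>2"
  by (simp add: norm_james.rep_eq sq_var_le_norm)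

lemma norm_james_leI:
  assumes "\<And>l. sorted l \<Longrightarrow> sq_var (james_seq x) l \<le> c\<^sup>2" "0 \<le> c"
  shows "norm x \<le> c"
  using james_norm_le_sq_varI(2)[OF assms] by (simp add: norm_james.rep_eq)

lemma james_seq_simps [simp]:
  "james_seq 0 n = 0"
  "james_seq (x + y) n = james_seq x n + james_seq y n"
  "james_seq (r *\<^sub>R x) n = r * james_seq x n"
  by (simp_all add: zero_james.rep_eq plus_james.rep_eq scaleR_james.rep_eq)

lemma james_seq_minus [simp]: "james_seq (- x) n = - james_seq x n"
  using james_seq_simps(3)[of "-1" x n] by simp

lemma james_seq_diff [simp]: "james_seq (x - y) n = james_seq x n - james_seq y n"
  using james_seq_simps(2)[of x "- y" n] by simp

lemma james_seq_sum [simp]: "james_seq (\<Sum>i\<in>I. x i) n = (\<Sum>i\<in>I. james_seq (x i) n)"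
  by (induction I rule: infinite_finite_induct) simp_all

lemma james_eqI: "(\<And>n. james_seq x n = james_seq y n) \<Longrightarrow> x = y"
  by (metis ext james_seq_inject)

lemma james_seq_le_norm: "\<bar>james_seq x n\<bar> \<le> norm x"
proof -
  have "(\<lambda>m. \<bar>james_seq x m - james_seq x n\<bar>) \<longlonglongrightarrow> \<bar>0 - james_seq x n\<bar>"
    by (intro tendsto_intros tendsto_james_seq)
  moreover have "\<forall>\<^sub>F m in sequentially. \<bar>james_seq x m - james_seq x n\<bar> \<le> norm x"
    using eventually_gt_at_top[of n]
  proof eventually_elim
    case (elim m)
    then show ?case
      using james_diff_le[OF bdd_james_seq elim, of x] by (simp add: norm_james.rep_eq)
  qed
  ultimately show ?thesis
    using tendsto_upperbound trivial_limit_sequentially by fastforce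
qed

lift_definition james_tail :: "nat \<Rightarrow> james \<Rightarrow> james" is "\<lambda>N x n. if n < N then 0 else x n"
proof -
  fix N :: nat and x :: "nat \<Rightarrow> real" assume x: "x \<in> james_seqs"
  let ?y = "\<lambda>n. if n < N then 0 else x n"
  have "sq_var ?y l \<le> (sqrt 2 * james_norm x)\<^sup>2" if "sorted l" for l
    using sq_var_tail[of x N "(james_norm x)\<^sup>2" l] sq_var_le_norm[of x] x that
    by (simp add: james_seqs_def power_mult_distrib)
  then have "bdd_above (james_variations ?y)"
    using x by (intro james_norm_le_sq_varI) (auto simp: james_seqs_def james_norm_nonneg)
  moreover have "?y \<longlonglongrightarrow> 0"
  proof (rule Lim_transform_eventually)
    show "x \<longlonglongrightarrow> 0" using x by (simp add: james_seqs_def)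
    show "\<forall>\<^sub>F n in sequentially. x n = ?y n"
      using eventually_ge_at_top[of N] by eventually_elim simp
  qed
  ultimately show "?y \<in> james_seqs" by (simp add: james_seqs_def)
qed

lemma james_seq_tail [simp]: "james_seq (james_tail N x) n = (if n < N then 0 else james_seq x n)"
  by (simp add: james_tail.rep_eq)

lemma norm_james_tail_le: "norm (james_tail N x) \<le> 2 * norm x"
proof (rule norm_james_leI)
  fix l :: "nat list" assume l: "sorted l"
  have "sq_var (james_seq (james_tail N x)) l \<le> 2 * (norm x)\<^sup>2"
    using sq_var_tail[OF tendsto_james_seq[of x] sq_var_james_le l, of N]
    by (simp add: james_tail.rep_eq)
  then show "sq_var (james_seq (james_tail N x)) l \<le> (2 * norm x)\<^sup>2"
    by (rule order_trans) (simp add: power_mult_distrib)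
qed simp

lemma james_tail_tendsto_0:
  fixes x :: james
  shows "(\<lambda>N. james_tail N x) \<longlonglongrightarrow> 0"
proof (rule LIMSEQ_I)
  fix r :: real assume r: "r > 0"
  obtain N where N: "\<And>l. sorted l \<Longrightarrow> set l \<subseteq> {N..} \<Longrightarrow> sq_var (james_seq x) l \<le> (r/2)\<^sup>2 / 2"
    using sq_var_tail_small[OF bdd_james_seq[of x], of "(r/2)\<^sup>2/2"] r by auto
  have "norm (james_tail M x) < r" if "N \<le> M" for M
  proof -
    have "norm (james_tail M x) \<le> r/2"
    proof (rule norm_james_leI)
      fix l :: "nat list" assume l: "sorted l"
      have "sq_var (james_seq x) l \<le> (r/2)\<^sup>2 / 2" if "sorted l" "set l \<subseteq> {M..}" for l
        using that \<open>N \<le> M\<close> by (intro N) auto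
      from sq_var_tail[OF tendsto_james_seq this l]
      show "sq_var (james_seq (james_tail M x)) l \<le> (r/2)\<^sup>2"
        by (simp add: james_tail.rep_eq)
    qed (use r in simp)
    then show ?thesis using r by linarith
  qed
  then show "\<exists>N. \<forall>M\<ge>N. norm (james_tail M x - 0) < r" by auto
qed

section \<open>Shrinking and descending sequences\<close>

text \<open>The successive drops are nonnegative, and a sum of squares of nonnegative numbers is at
  most the square of their sum.\<close>

lemma sq_var_antimono_le:
  assumes "antimono x" "sorted l" "l \<noteq> []"
  shows "sq_var x l \<le> (x (hd l) - x (last l))\<^sup>2"
  using assms(2,3)
proof (induction l rule: induct_list012)
  case (3 a b l)
  have *: "(u - w)\<^sup>2 + (w - v)\<^sup>2 \<le> (u - v)\<^sup>2" if "w \<le> u" "v \<le> w" for u v w :: real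
    using mult_nonneg_nonneg[of "u - w" "w - v"] that by (simp add: power2_eq_square algebra_simps)
  have "last (b # l) \<in> set (b # l)" by (rule last_in_set) simp
  then have "b \<le> last (b # l)" using 3 by auto
  then have "x b \<le> x a" "x (last (b # l)) \<le> x b"
    using 3 assms(1) by (auto simp: antimono_def)
  from *[OF this] show ?case
    using 3 by (simp add: power2_commute[of "x b"])
qed auto

lemma antimono_james:
  assumes x: "antimono x" and 1: "x 0 \<le> 1" and 0: "\<And>n. n \<ge> M \<Longrightarrow> x n = 0"
  shows "x \<in> james_seqs" "james_norm x \<le> 1"
proof -
  have x01: "0 \<le> x n \<and> x n \<le> 1" for n
    using 1 0[of "max n M"] antimonoD[OF x, of 0 n] antimonoD[OF x, of n "max n M"] by simp
  have "sq_var x l \<le> 1\<^sup>2" if "sorted l" for l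
  proof (cases "l = []")
    case False
    have "\<bar>x (hd l) - x (last l)\<bar> \<le> 1"
      using x01[of "hd l"] x01[of "last l"] by linarith
    then have "(x (hd l) - x (last l))\<^sup>2 \<le> 1\<^sup>2"
      using abs_le_square_iff[of "x (hd l) - x (last l)" 1] by simp
    then show ?thesis
      using sq_var_antimono_le[OF x that False] by linarith
  qed simp
  then have "bdd_above (james_variations x) \<and> james_norm x \<le> 1"
    using james_norm_le_sq_varI[of x 1] by simp
  moreover have "x \<longlonglongrightarrow> 0"
    using 0 by (intro tendsto_eventually eventually_sequentiallyI[of M])
  ultimately show "x \<in> james_seqs" "james_norm x \<le> 1"
    by (auto simp: james_seqs_def)
qed

lift_definition james_step :: "nat \<Rightarrow> james" is "\<lambda>N n. if n < N then 1 else 0"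
  subgoal for N by (rule antimono_james(1)[of _ N]) (auto simp: antimono_def)
  done

lemma james_seq_step [simp]: "james_seq (james_step N) n = (if n < N then 1 else 0)"
  by (simp add: james_step.rep_eq)

lemma norm_james_step_le: "norm (james_step N) \<le> 1"
  unfolding norm_james.rep_eq james_step.rep_eq
  by (rule antimono_james(2)[of _ N]) (auto simp: antimono_def)

section \<open>Unit vectors, truncations and descents\<close>

definition james_unit :: "nat \<Rightarrow> james" where
  "james_unit n = james_step (Suc n) - james_step n"

lemma james_seq_unit [simp]: "james_seq (james_unit m) n = (if n = m then 1 else 0)"
  by (auto simp: james_unit_def)

definition james_trunc :: "nat \<Rightarrow> james \<Rightarrow> james" where
  "james_trunc N x = (\<Sum>n<N. james_seq x n *\<^sub>R james_unit n)"

lemma james_seq_trunc [simp]: "james_seq (james_trunc N x) n = (if n < N then james_seq x n else 0)"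
  using sum.delta'[of "{..<N}" n "james_seq x"]
  by (simp add: james_trunc_def if_distrib[of "(*) _"] cong: if_cong)

lemma james_trunc_eq: "james_trunc N x = x - james_tail N x"
  by (rule james_eqI) simp

lemma james_trunc_tendsto: "(\<lambda>N. james_trunc N x) \<longlonglongrightarrow> x"
  using tendsto_diff[OF tendsto_const[of x] james_tail_tendsto_0[of x]] by (simp add: james_trunc_eq)

lift_definition james_coord :: "nat \<Rightarrow> james \<Rightarrow>\<^sub>L real" is "\<lambda>n x. james_seq x n"
  by (rule bounded_linear_intro[where K = 1]) (auto simp: james_seq_le_norm)

declare james_coord.rep_eq [simp]

text \<open>A convex class containing the late steps, within which all convex combinations are
  taken. The plateau includes \<open>N\<close> itself, so the first step that belongs to it is
  \<open>james_step (Suc N)\<close>.\<close>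

definition descents :: "nat \<Rightarrow> james set" where
  "descents N = {t. antimono (james_seq t) \<and> (\<forall>n\<le>N. james_seq t n = 1) \<and> (\<exists>M. \<forall>n\<ge>M. james_seq t n = 0)}"

lemma norm_descents_le: "t \<in> descents N \<Longrightarrow> norm t \<le> 1"
  using antimono_james(2)[of "james_seq t"] by (auto simp: descents_def norm_james.rep_eq)

lemma james_step_in_descents: "james_step (Suc N) \<in> descents N"
  by (auto simp: descents_def antimono_def intro!: exI[of _ "Suc N"])

lemma descents_mono: "M \<le> N \<Longrightarrow> descents N \<subseteq> descents M"
  by (auto simp: descents_def)

lemma convex_descents: "convex (descents N)"
  unfolding convex_def
proof (intro ballI allI impI)
  fix x y and u v :: real assume xy: "x \<in> descents N" "y \<in> descents N" and uv: "0 \<le> u" "0 \<le> v" "u + v = 1"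
  from xy obtain A B where AB: "\<And>n. n \<ge> A \<Longrightarrow> james_seq x n = 0" "\<And>n. n \<ge> B \<Longrightarrow> james_seq y n = 0"
    by (auto simp: descents_def)
  have "antimono (james_seq (u *\<^sub>R x + v *\<^sub>R y))"
    using xy uv by (auto simp: descents_def antimono_def intro!: add_mono mult_left_mono)
  moreover have "\<exists>M. \<forall>n\<ge>M. james_seq (u *\<^sub>R x + v *\<^sub>R y) n = 0"
    using AB by (intro exI[of _ "max A B"]) auto
  ultimately show "u *\<^sub>R x + v *\<^sub>R y \<in> descents N"
    using xy uv by (simp add: descents_def)
qed

text \<open>
  The end terms absorb the jump between consecutive blocks, since \<open>(a - b)\<^sup>2 \<le> 2 a\<^sup>2 + 2 b\<^sup>2\<close>; this makes
  bounds on the anchored variation additive.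
\<close>

definition anchored_var :: "(nat \<Rightarrow> real) \<Rightarrow> nat list \<Rightarrow> real" where
  "anchored_var x l = 2 * (x (hd l))\<^sup>2 + sq_var x l + 2 * (x (last l))\<^sup>2"

text \<open>Each coordinate is bounded by the norm, so the two ends contribute 4 and the variation
  contributes 1.\<close>

lemma anchored_var_le:
  assumes "sorted l" shows "anchored_var (james_seq x) l \<le> 5 * (norm x)\<^sup>2"
proof -
  have "(james_seq x n)\<^sup>2 \<le> (norm x)\<^sup>2" for n
    using james_seq_le_norm[of x n] abs_le_square_iff[of "james_seq x n" "norm x"] by simp
  then show ?thesis
    using sq_var_james_le[OF assms, of x] unfolding anchored_var_def
    by (smt (verit, ccfv_threshold))
qed

text \<open>Cut the list at \<open>B\<close>: each half sees only one summand, and the two anchors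
  at the cut pay for the jump between the halves.\<close>

lemma anchored_var_disjoint:
  assumes y: "\<And>n. n \<ge> B \<Longrightarrow> y n = 0" and z: "\<And>n. n < B \<Longrightarrow> z n = 0"
    and \<alpha>: "\<And>l. sorted l \<Longrightarrow> l \<noteq> [] \<Longrightarrow> anchored_var y l \<le> \<alpha>" "0 \<le> \<alpha>"
    and \<beta>: "\<And>l. sorted l \<Longrightarrow> l \<noteq> [] \<Longrightarrow> anchored_var z l \<le> \<beta>" "0 \<le> \<beta>"
    and l: "sorted l" "l \<noteq> []"
  shows "anchored_var (\<lambda>n. y n + z n) l \<le> \<alpha> + \<beta>"
proof -
  let ?x = "\<lambda>n. y n + z n"
  obtain l1 l2 where l12: "l = l1 @ l2" "\<forall>n\<in>set l1. n < B" "\<forall>n\<in>set l2. B \<le> n"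
    using sorted_split[OF l(1)] by blast
  have s: "sorted l1" "sorted l2" using l(1) l12 by (auto simp: sorted_append)
  have v1: "sq_var ?x l1 = sq_var y l1"
    using l12(2) z by (intro sq_var_cong) auto
  have v2: "sq_var ?x l2 = sq_var z l2"
    using l12(3) y by (intro sq_var_cong) auto
  have e1: "?x (hd l1) = y (hd l1)" "?x (last l1) = y (last l1)" if "l1 \<noteq> []"
    using z l12(2) that by auto
  have e2: "?x (hd l2) = z (hd l2)" "?x (last l2) = z (last l2)" if "l2 \<noteq> []"
    using y l12(3) that by auto
  consider "l1 = []" "l2 \<noteq> []" | "l1 \<noteq> []" "l2 = []" | "l1 \<noteq> []" "l2 \<noteq> []"
    using l(2) l12(1) by blast
  then show ?thesis
  proof cases
    case 1
    then have "anchored_var ?x l = anchored_var z l2"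
      using v2 e2 l12(1) by (simp add: anchored_var_def)
    then show ?thesis using \<beta>(1)[OF s(2)] 1 \<alpha>(2) by simp
  next
    case 2
    then have "anchored_var ?x l = anchored_var y l1"
      using v1 e1 l12(1) by (simp add: anchored_var_def)
    then show ?thesis using \<alpha>(1)[OF s(1)] 2 \<beta>(2) by simp
  next
    case 3
    have "(z (hd l2) - y (last l1))\<^sup>2 \<le> 2 * (z (hd l2))\<^sup>2 + 2 * (y (last l1))\<^sup>2"
      using zero_le_power2[of "z (hd l2) + y (last l1)"] by (simp add: power2_eq_square algebra_simps)
    moreover have "anchored_var ?x l =
        2 * (y (hd l1))\<^sup>2 + sq_var y l1 + (z (hd l2) - y (last l1))\<^sup>2 + sq_var z l2 + 2 * (z (last l2))\<^sup>2"
      using 3 v1 v2 e1 e2 l12(1) sq_var_append[of l1 l2 ?x] by (simp add: anchored_var_def)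
    ultimately show ?thesis
      using \<alpha>(1)[OF s(1)] \<beta>(1)[OF s(2)] 3 by (simp add: anchored_var_def)
  qed
qed

text \<open>This expresses that the unit vectors form a shrinking basis. Otherwise there are
  successive disjoint blocks of norm at most 1 on which \<open>f\<close> exceeds \<open>e\<close>. A
  sum of \<open>K\<close> such blocks has norm of order \<open>sqrt K\<close>, while
  \<open>f\<close> is at least \<open>K * e\<close> there.\<close>

lemma james_functional_small_on_tails:
  fixes f :: "james \<Rightarrow>\<^sub>L real"
  assumes e: "e > 0"
  shows "\<exists>N. \<forall>x. (\<forall>n<N. james_seq x n = 0) \<longrightarrow> \<bar>f x\<bar> \<le> e * norm x"
proof (rule ccontr)
  assume neg: "\<not> ?thesis"
  have block: "\<exists>x M. (\<forall>n<N. james_seq x n = 0) \<and> (\<forall>n\<ge>M. james_seq x n = 0) \<and> norm x \<le> 1 \<and> f x > e" for N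
  proof -
    obtain x0 where x0: "\<forall>n<N. james_seq x0 n = 0" "\<bar>f x0\<bar> > e * norm x0"
      using neg by (auto simp: not_le)
    define x where "x = (if f x0 \<ge> 0 then x0 else - x0)"
    have x: "\<forall>n<N. james_seq x n = 0" "f x - e * norm x > 0"
      using x0 by (auto simp: x_def blinfun.minus_right)
    \<comment> \<open>The strict inequality survives truncation by continuity. The block becomes
      finitely supported, so that the next one can start behind it.\<close>
    have "(\<lambda>M. f (james_trunc M x) - e * norm (james_trunc M x)) \<longlonglongrightarrow> f x - e * norm x"
      by (intro tendsto_intros james_trunc_tendsto blinfun.tendsto)
    from order_tendstoD(1)[OF this x(2)] obtain M where
      M: "f (james_trunc M x) - e * norm (james_trunc M x) > 0"
      by (auto simp: eventually_sequentially)
    define y where "y = james_trunc M x"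
    have "y \<noteq> 0" using M by (auto simp: y_def)
    then have "f (y /\<^sub>R norm y) > e"
      using M by (simp add: y_def[symmetric] blinfun.scaleR_right field_simps)
    then show ?thesis
      using x \<open>y \<noteq> 0\<close> by (intro exI[of _ "y /\<^sub>R norm y"] exI[of _ M]) (auto simp: y_def)
  qed
  have sums: "\<exists>x M. (\<forall>n\<ge>M. james_seq x n = 0) \<and> f x \<ge> real K * e \<and>
      (\<forall>l. sorted l \<longrightarrow> l \<noteq> [] \<longrightarrow> anchored_var (james_seq x) l \<le> 5 * real K)" for K
  proof (induction K)
    case 0
    show ?case
      by (intro exI[of _ 0]) (auto simp: anchored_var_def sq_var_def)
  next
    case (Suc K)
    then obtain x M where x: "\<forall>n\<ge>M. james_seq x n = 0" "f x \<ge> real K * e"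
      "\<And>l. sorted l \<Longrightarrow> l \<noteq> [] \<Longrightarrow> anchored_var (james_seq x) l \<le> 5 * real K" by blast
    obtain y M' where y: "\<forall>n<M. james_seq y n = 0" "\<forall>n\<ge>M'. james_seq y n = 0" "norm y \<le> 1" "f y > e"
      using block[of M] by blast
    have "(norm y)\<^sup>2 \<le> 1"
      using y(3) by (simp add: power_le_one)
    then have a: "anchored_var (james_seq y) l \<le> 5" if "sorted l" for l
      using anchored_var_le[OF that, of y] by linarith
    have "anchored_var (\<lambda>n. james_seq x n + james_seq y n) l \<le> 5 * real K + 5"
      if "sorted l" "l \<noteq> []" for l
      by (rule anchored_var_disjoint[of M, OF _ _ x(3) _ a]) (use x(1) y(1) that in auto)
    moreover have "(\<lambda>n. james_seq x n + james_seq y n) = james_seq (x + y)"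
      by auto
    ultimately have "anchored_var (james_seq (x + y)) l \<le> 5 * real (Suc K)"
      if "sorted l" "l \<noteq> []" for l
      using that by (simp add: algebra_simps)
    moreover have "f (x + y) \<ge> real (Suc K) * e"
      using x(2) y(4) by (simp add: blinfun.add_right algebra_simps)
    moreover have "\<forall>n\<ge>max M M'. james_seq (x + y) n = 0"
      using x(1) y(2) by simp
    ultimately show ?case by blast
  qed
  \<comment> \<open>Squaring \<open>K * e \<le> norm f * sqrt (5 * K)\<close> and cancelling one
    factor \<open>K\<close> leaves a right-hand side independent of \<open>K\<close>.\<close>
  have *: "real K * e\<^sup>2 \<le> 5 * (norm f)\<^sup>2" if "K > 0" for K
  proof -
    obtain x where x: "f x \<ge> real K * e"
      "\<And>l. sorted l \<Longrightarrow> l \<noteq> [] \<Longrightarrow> anchored_var (james_seq x) l \<le> 5 * real K"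
      using sums[of K] by blast
    have "norm x \<le> sqrt (5 * real K)"
    proof (rule norm_james_leI)
      fix l :: "nat list" assume l: "sorted l"
      have "sq_var (james_seq x) l \<le> anchored_var (james_seq x) l"
        by (simp add: anchored_var_def)
      then show "sq_var (james_seq x) l \<le> (sqrt (5 * real K))\<^sup>2"
        using x(2)[OF l] by (cases "l = []") auto
    qed simp
    then have "norm f * norm x \<le> norm f * sqrt (5 * real K)"
      by (simp add: mult_left_mono)
    moreover have "f x \<le> norm f * norm x"
      using norm_blinfun[of f x] by simp
    ultimately have "real K * e \<le> norm f * sqrt (5 * real K)"
      using x(1) by linarith
    then have "(real K * e)\<^sup>2 \<le> (norm f * sqrt (5 * real K))\<^sup>2"
      using e by (intro power_mono) auto
    then have "real K * (real K * e\<^sup>2) \<le> real K * (5 * (norm f)\<^sup>2)"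
      by (simp add: power_mult_distrib power2_eq_square algebra_simps)
    then show ?thesis using that by simp
  qed
  obtain K :: nat where K: "5 * (norm f)\<^sup>2 / e\<^sup>2 < real K"
    using reals_Archimedean2 by blast
  then have "0 < K"
    using le_less_trans[OF _ K, of 0] by simp
  then show False
    using *[of K] K e by (simp add: field_simps)
qed

section \<open>The limit functional in the bidual\<close>

lemma convergent_james_step: "convergent (\<lambda>n. blinfun_apply f (james_step n))"
  for f :: "james \<Rightarrow>\<^sub>L real"
proof (rule Cauchy_convergent, rule CauchyI)
  fix e :: real assume e: "e > 0"
  obtain N where N: "\<And>x. (\<forall>n<N. james_seq x n = 0) \<Longrightarrow> \<bar>f x\<bar> \<le> e/3 * norm x"
    using james_functional_small_on_tails[of "e/3" f] e by auto
  have "\<bar>f (james_step m) - f (james_step n)\<bar> < e" if "N \<le> m" "N \<le> n" for m n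
  proof -
    have "\<bar>f (james_step m - james_step n)\<bar> \<le> e/3 * norm (james_step m - james_step n)"
      using that by (intro N) auto
    also have "\<dots> \<le> e/3 * 2"
      using norm_triangle_ineq4[of "james_step m" "james_step n"] norm_james_step_le[of m] norm_james_step_le[of n] e
      by (intro mult_left_mono) auto
    also have "\<dots> < e" using e by simp
    finally show ?thesis by (simp add: blinfun.diff_right)
  qed
  then show "\<exists>M. \<forall>m\<ge>M. \<forall>n\<ge>M. norm (f (james_step m) - f (james_step n)) < e"
    by auto
qed

text \<open>This element of the bidual has value 1 at every coordinate functional. It corresponds to
  the constant sequence 1, which does not lie in \<open>J\<close>.\<close>

definition james_limit :: "(james \<Rightarrow>\<^sub>L real) \<Rightarrow>\<^sub>L real" where
  "james_limit = Blinfun (\<lambda>f. lim (\<lambda>n. blinfun_apply f (james_step n)))"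

lemma james_limit_apply: "james_limit f = lim (\<lambda>n. blinfun_apply f (james_step n))"
  unfolding james_limit_def
proof (intro bounded_linear_Blinfun_apply[THEN fun_cong], rule bounded_linear_intro[where K = 1])
  note L = convergent_james_step[unfolded convergent_LIMSEQ_iff]
  fix f g :: "james \<Rightarrow>\<^sub>L real" and r :: real
  show "lim (\<lambda>n. (f + g) (james_step n)) = lim (\<lambda>n. f (james_step n)) + lim (\<lambda>n. g (james_step n))"
    using tendsto_add[OF L[of f] L[of g]] by (simp add: blinfun.add_left limI)
  show "lim (\<lambda>n. (r *\<^sub>R f) (james_step n)) = r *\<^sub>R lim (\<lambda>n. f (james_step n))"
    using tendsto_mult[OF tendsto_const L[of f]] by (simp add: blinfun.scaleR_left limI)
  have "\<bar>f (james_step n)\<bar> \<le> norm f" for n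
    using norm_blinfun[of f "james_step n"] mult_left_mono[OF norm_james_step_le[of n], of "norm f"]
    by simp
  then show "norm (lim (\<lambda>n. f (james_step n))) \<le> norm f * 1"
    using tendsto_upperbound[OF tendsto_rabs[OF L[of f]] _ trivial_limit_sequentially, of "norm f"] by simp
qed

lemma james_limit: "(\<lambda>n. blinfun_apply f (james_step n)) \<longlonglongrightarrow> blinfun_apply james_limit f"
  using convergent_james_step by (simp add: james_limit_apply convergent_LIMSEQ_iff)

text \<open>All members of \<open>descents K\<close> agree up to \<open>K\<close>, so a descent
  differs from one fixed late step by a vector supported far out, where \<open>f\<close> is
  small.\<close>

lemma descents_near_limit:
  fixes f :: "james \<Rightarrow>\<^sub>L real"
  assumes e: "e > 0"
  shows "\<exists>N. \<forall>t\<in>descents N. \<bar>f t - james_limit f\<bar> < e"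
proof -
  obtain N where N: "\<And>x. (\<forall>n<N. james_seq x n = 0) \<Longrightarrow> \<bar>f x\<bar> \<le> e/4 * norm x"
    using james_functional_small_on_tails[of "e/4" f] e by auto
  obtain M where M: "\<And>n. n \<ge> M \<Longrightarrow> \<bar>f (james_step n) - james_limit f\<bar> < e/2"
    using LIMSEQ_D[OF james_limit[of f], of "e/2"] e by auto
  define K where "K = max M N"
  have "\<bar>f t - james_limit f\<bar> < e" if t: "t \<in> descents K" for t
  proof -
    have "\<bar>f (t - james_step (Suc K))\<bar> \<le> e/4 * norm (t - james_step (Suc K))"
      using t by (intro N) (auto simp: descents_def K_def)
    also have "\<dots> \<le> e/4 * 2"
      using norm_triangle_ineq4[of t "james_step (Suc K)"] norm_descents_le[OF t]
        norm_descents_le[OF james_step_in_descents[of K]] e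
      by (intro mult_left_mono) auto
    finally have "\<bar>f t - f (james_step (Suc K))\<bar> \<le> e/2" by (simp add: blinfun.diff_right)
    moreover have "\<bar>f (james_step (Suc K)) - james_limit f\<bar> < e/2"
      by (rule M) (simp add: K_def)
    ultimately show ?thesis by linarith
  qed
  then show ?thesis by blast
qed

section \<open>Weakly compact operators on dual spaces\<close>

text \<open>The image of \<open>D\<close> in the plane misses a closed quadrant. The normal of a
  separating line has nonnegative entries, and scaling their sum to 1 gives the weights.\<close>

lemma two_functional_minimax:
  fixes p q :: "'a::real_vector \<Rightarrow> real"
  assumes D: "convex D" and lin: "linear p" "linear q"
    and cov: "\<And>x. x \<in> D \<Longrightarrow> p x < c \<or> q x < c"
  shows "\<exists>\<mu>. 0 \<le> \<mu> \<and> \<mu> \<le> 1 \<and> (\<forall>x\<in>D. \<mu> * p x + (1 - \<mu>) * q x \<le> c)"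
proof (cases "D = {}")
  case False
  define S where "S = (\<lambda>x. (p x, q x)) ` D"
  define Q :: "(real \<times> real) set" where "Q = {c..} \<times> {c..}"
  have "linear (\<lambda>x. (p x, q x))"
    using lin by (simp add: linear_iff)
  then have "convex S" unfolding S_def by (rule convex_linear_image[OF _ D])
  moreover have "convex Q" unfolding Q_def by (intro convex_Times convex_real_interval)
  moreover have "S \<noteq> {}" "Q \<noteq> {}" "S \<inter> Q = {}"
    using False cov unfolding S_def Q_def by (auto simp: not_le[symmetric])
  ultimately obtain w b where w: "w \<noteq> 0" "\<And>z. z \<in> S \<Longrightarrow> inner w z \<le> b" "\<And>z. z \<in> Q \<Longrightarrow> b \<le> inner w z"
    using separating_hyperplane_sets[of S Q] by blast
  obtain u v where uv: "w = (u, v)" by (cases w)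
  have Q: "b \<le> u * s + v * t" if "c \<le> s" "c \<le> t" for s t
    using w(3)[of "(s, t)"] that by (simp add: uv Q_def)
  \<comment> \<open>An affine function bounded below on \<open>{c..}\<close> has nonnegative slope:
    for negative \<open>r\<close>, the shift \<open>h\<close> pushes the value at
    \<open>c + h\<close> below \<open>b\<close>.\<close>
  have nonneg: "0 \<le> r" if "\<And>s. c \<le> s \<Longrightarrow> b \<le> r * s + d" for r d
  proof (rule ccontr)
    assume r: "\<not> 0 \<le> r"
    define h where "h = (1 + \<bar>r * c + d - b\<bar>) / (- r)"
    have "0 \<le> h" using r by (simp add: h_def field_simps)
    then have "b \<le> r * (c + h) + d" by (intro that) simp
    moreover have "r * h = - (1 + \<bar>r * c + d - b\<bar>)" using r by (simp add: h_def)
    ultimately show False by (simp add: algebra_simps)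
  qed
  have u: "0 \<le> u" using nonneg[of u "v * c"] Q by simp
  have v: "0 \<le> v" using nonneg[of v "u * c"] Q by (simp add: add.commute)
  have pos: "0 < u + v"
    using u v w(1) uv by (auto simp: zero_prod_def less_le)
  have "u / (u + v) * p x + (1 - u / (u + v)) * q x \<le> c" if "x \<in> D" for x
  proof -
    have "u * p x + v * q x \<le> b"
      using w(2)[of "(p x, q x)"] that by (auto simp: S_def uv)
    also have "b \<le> (u + v) * c"
      using Q[of c c] by (simp add: algebra_simps)
    finally have "(u * p x + v * q x) / (u + v) \<le> c"
      using pos by (simp add: pos_divide_le_eq mult.commute)
    moreover have "1 - u / (u + v) = v / (u + v)"
      using pos by (simp add: field_simps)
    ultimately show ?thesis
      by (simp add: add_divide_distrib)
  qed
  then show ?thesis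
    using u v pos by (intro exI[of _ "u / (u + v)"]) (auto simp: divide_simps)
qed auto

text \<open>On the part of \<open>D\<close> where \<open>h i\<close> is at least \<open>a\<close>,
  the remaining functionals satisfy the covering hypothesis and yield one combination. The case of
  two functionals merges it with \<open>h i\<close>. The gap between \<open>a\<close> and
  \<open>b\<close> absorbs the nonstrict inequality obtained there.\<close>

lemma finite_minimax:
  fixes h :: "'j \<Rightarrow> 'a::real_vector \<Rightarrow> real"
  assumes "finite J" "J \<noteq> {}" "convex D" "\<And>j. j \<in> J \<Longrightarrow> linear (h j)"
    and "\<And>x. x \<in> D \<Longrightarrow> \<exists>j\<in>J. h j x < a" "a < b"
  shows "\<exists>w. (\<forall>j\<in>J. 0 \<le> w j) \<and> sum w J = 1 \<and> (\<forall>x\<in>D. (\<Sum>j\<in>J. w j * h j x) < b)"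
  using assms
proof (induction J arbitrary: D a b rule: finite_ne_induct)
  case (singleton j)
  then show ?case by (intro exI[of _ "\<lambda>_. 1"]) fastforce
next
  case (insert i J)
  obtain c where c: "a < c" "c < b" using dense[OF insert.prems(4)] by blast
  have li: "linear (h i)" and lJ: "\<And>j. j \<in> J \<Longrightarrow> linear (h j)" using insert.prems(2) by auto
  define D' where "D' = D \<inter> h i -` {a..}"
  have "convex D'"
    unfolding D'_def by (intro convex_Int insert.prems convex_linear_vimage li) (rule convex_real_interval)
  moreover have "\<exists>j\<in>J. h j x < a" if "x \<in> D'" for x
    using insert.prems(3)[of x] that by (auto simp: D'_def)
  ultimately obtain w where w: "\<And>j. j \<in> J \<Longrightarrow> 0 \<le> w j" "sum w J = 1"
    "\<And>x. x \<in> D' \<Longrightarrow> (\<Sum>j\<in>J. w j * h j x) < c"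
    using insert.IH[of D' a c] lJ c(1) by blast
  define g where "g x = (\<Sum>j\<in>J. w j * h j x)" for x
  have "linear g"
    unfolding g_def using lJ by (intro linear_compose_sum ballI linear_cmul[unfolded real_scaleR_def])
     (auto simp: linear_iff algebra_simps)
  moreover have "h i x < c \<or> g x < c" if "x \<in> D" for x
    using w(3)[of x] that c(1) by (force simp: D'_def g_def)
  ultimately obtain \<mu> where \<mu>: "0 \<le> \<mu>" "\<mu> \<le> 1" "\<And>x. x \<in> D \<Longrightarrow> \<mu> * h i x + (1 - \<mu>) * g x \<le> c"
    using two_functional_minimax[OF insert.prems(1) li] by blast
  define w' where "w' j = (if j = i then \<mu> else (1 - \<mu>) * w j)" for j
  have J: "(\<Sum>j\<in>J. w' j * k j) = (1 - \<mu>) * (\<Sum>j\<in>J. w j * k j)" for k :: "'j \<Rightarrow> real"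
    unfolding sum_distrib_left using insert.hyps(3) by (intro sum.cong) (auto simp: w'_def)
  have "sum w' (insert i J) = 1"
    using insert.hyps J[of "\<lambda>_. 1"] w(2) by (simp add: w'_def)
  moreover have "(\<Sum>j\<in>insert i J. w' j * h j x) < b" if "x \<in> D" for x
    using insert.hyps J[of "\<lambda>j. h j x"] \<mu>(3)[OF that] c(2) by (simp add: w'_def[of i] g_def)
  moreover have "0 \<le> w' j" if "j \<in> insert i J" for j
    using that \<mu> w(1) by (auto simp: w'_def)
  ultimately show ?case by blast
qed

section \<open>Weak topology and weak compactness\<close>

lemma continuous_map_weak_apply:
  "continuous_map weak_topology euclideanreal (blinfun_apply f)"
proof -
  have "continuous_map weak_topology euclideanreal
      ((\<lambda>h. h f) \<circ> (\<lambda>x. \<lambda>f. blinfun_apply f x))"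
    unfolding weak_topology_def
    by (intro continuous_map_pullback) (simp add: continuous_on_product_coordinates)
  then show ?thesis by (simp add: o_def)
qed

lemma topspace_weak [simp]: "topspace weak_topology = UNIV"
  by (simp add: weak_topology_def topspace_pullback_topology)

text \<open>Compactness leaves finitely many of the weakly open sets where \<open>\<psi> n\<close>
  is below \<open>e/2\<close> to cover the image of the ball. The minimax lemma then replaces an
  index depending on the point by fixed weights.\<close>

lemma weakly_compact_convex_combination:
  fixes T :: "'e::banach \<Rightarrow>\<^sub>L 'e" and \<psi> :: "nat \<Rightarrow> 'e \<Rightarrow>\<^sub>L real"
  assumes T: "T \<in> weakly_compact_operators" and lim: "\<And>y. (\<lambda>n. \<psi> n y) \<longlonglongrightarrow> 0" and e: "e > 0"
  shows "\<exists>J w. finite J \<and> (\<forall>j\<in>J. 0 \<le> w j) \<and> sum w J = 1 \<and>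
    (\<forall>y\<in>cball 0 1. \<bar>\<Sum>j\<in>J. w j * \<psi> j (T y)\<bar> < e)"
proof -
  define D where "D = blinfun_apply T ` cball 0 1"
  define C where "C = weak_topology closure_of D"
  have C: "compactin weak_topology C"
    using T by (simp add: weakly_compact_operators_def C_def D_def)
  have "D \<subseteq> C" unfolding C_def by (rule closure_of_subset) simp
  have "convex D"
    unfolding D_def by (intro convex_linear_image convex_cball) (simp add: blinfun.bounded_linear_right bounded_linear.linear)
  define \<O> where "\<O> n = {y. \<psi> n y < e/2}" for n
  have op: "openin weak_topology (\<O> n)" for n
    using openin_continuous_map_preimage[OF continuous_map_weak_apply[of "\<psi> n"], of "{..<e/2}"]
    by (simp add: \<O>_def)
  have "\<exists>n. y \<in> \<O> n" for y
    using order_tendstoD(2)[OF lim[of y], of "e/2"] e by (auto simp: \<O>_def eventually_sequentially)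
  then have "C \<subseteq> \<Union> (range \<O>)" by auto
  with C op obtain \<F> where \<F>: "finite \<F>" "\<F> \<subseteq> range \<O>" "C \<subseteq> \<Union>\<F>"
    unfolding compactin_def by (metis (no_types, lifting) imageE)
  obtain J where J: "finite J" "\<F> = \<O> ` J"
    using finite_subset_image[OF \<F>(1,2)] by blast
  have "0 \<in> D" unfolding D_def by (rule image_eqI[of _ _ 0]) auto
  then have "J \<noteq> {}" using \<F>(3) J(2) \<open>D \<subseteq> C\<close> by auto
  have "\<exists>w. (\<forall>j\<in>J. 0 \<le> w j) \<and> sum w J = 1 \<and> (\<forall>x\<in>D. (\<Sum>j\<in>J. w j * \<psi> j x) < e)"
  proof (rule finite_minimax[where a = "e/2"])
    show "\<exists>j\<in>J. \<psi> j x < e/2" if "x \<in> D" for x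
      using that \<open>D \<subseteq> C\<close> \<F>(3) J(2) by (auto simp: \<O>_def)
    show "linear (blinfun_apply (\<psi> j))" for j
      by (simp add: blinfun.bounded_linear_right bounded_linear.linear)
  qed (use J e \<open>J \<noteq> {}\<close> \<open>convex D\<close> in auto)
  then obtain w where w: "\<And>j. j \<in> J \<Longrightarrow> 0 \<le> w j" "sum w J = 1"
    "\<And>x. x \<in> D \<Longrightarrow> (\<Sum>j\<in>J. w j * \<psi> j x) < e" by blast
  \<comment> \<open>The image of the ball is symmetric, so the one-sided bound at \<open>T y\<close>
    and \<open>T (- y)\<close> controls the absolute value.\<close>
  have "\<bar>\<Sum>j\<in>J. w j * \<psi> j (T y)\<bar> < e" if y: "y \<in> cball 0 1" for y
  proof -
    have "T y \<in> D" "T (- y) \<in> D" using y by (auto simp: D_def intro!: imageI simp del: blinfun.minus_right)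
    from w(3)[OF this(1)] w(3)[OF this(2)] show ?thesis
      by (simp add: blinfun.minus_right sum_negf abs_less_iff)
  qed
  then show ?thesis using J(1) w by blast
qed

text \<open>
  By the Banach-Alaoglu theorem it suffices that precomposition with \<open>U\<close> is continuous on the unit
  ball from the topology of pointwise convergence to the weak topology, that is, that the biadjoint
  of \<open>U\<close> takes its values in \<open>'a\<close>.
\<close>

lemma weakly_compact_precomposition:
  fixes U :: "'a::real_normed_vector \<Rightarrow>\<^sub>L 'a"
    and V :: "('a \<Rightarrow>\<^sub>L real) \<Rightarrow>\<^sub>L ('a \<Rightarrow>\<^sub>L real)"
  assumes V: "\<And>f. V f = f o\<^sub>L U"
    and range: "\<And>\<Phi> :: ('a \<Rightarrow>\<^sub>L real) \<Rightarrow>\<^sub>L real. \<exists>z. \<forall>f. \<Phi> (f o\<^sub>L U) = f z"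
  shows "V \<in> weakly_compact_operators"
proof -
  define B where "B = blinfun_apply ` (cball 0 1 :: ('a \<Rightarrow>\<^sub>L real) set)"
  define K where "K = PiE UNIV (\<lambda>x::'a. {- norm x..norm x})"
  \<comment> \<open>The dual unit ball sits in a product of compact intervals, cut out by the closed
    conditions of additivity and homogeneity.\<close>
  have B_eq: "B = K \<inter> (\<Inter>x. \<Inter>y. {\<phi>. \<phi> (x + y) = \<phi> x + \<phi> y}) \<inter> (\<Inter>r. \<Inter>x. {\<phi>. \<phi> (r *\<^sub>R x) = r * \<phi> x})"
  proof (intro equalityI subsetI)
    fix \<phi> assume "\<phi> \<in> B"
    then obtain f :: "'a \<Rightarrow>\<^sub>L real" where f: "\<phi> = f" "norm f \<le> 1" by (auto simp: B_def)
    have "\<bar>f x\<bar> \<le> norm x" for x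
      using norm_blinfun[of f x] mult_right_mono[OF f(2) norm_ge_zero[of x]] by simp
    then show "\<phi> \<in> K \<inter> (\<Inter>x. \<Inter>y. {\<phi>. \<phi> (x + y) = \<phi> x + \<phi> y}) \<inter> (\<Inter>r. \<Inter>x. {\<phi>. \<phi> (r *\<^sub>R x) = r * \<phi> x})"
      by (auto simp: f K_def abs_le_iff blinfun.add_right blinfun.scaleR_right minus_le_iff)
  next
    fix \<phi> assume \<phi>: "\<phi> \<in> K \<inter> (\<Inter>x. \<Inter>y. {\<phi>. \<phi> (x + y) = \<phi> x + \<phi> y}) \<inter> (\<Inter>r. \<Inter>x. {\<phi>. \<phi> (r *\<^sub>R x) = r * \<phi> x})"
    have b: "\<bar>\<phi> x\<bar> \<le> 1 * norm x" for x
    proof -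
      have "\<phi> x \<in> {- norm x..norm x}" using \<phi> by (auto simp: K_def)
      then show ?thesis by auto
    qed
    have bl: "bounded_linear \<phi>"
      using \<phi> b by (intro bounded_linear_intro[where K = 1]) (auto simp: mult.commute)
    then have "norm (Blinfun \<phi>) \<le> 1"
      using b by (intro norm_blinfun_bound) (auto simp: bounded_linear_Blinfun_apply)
    then show "\<phi> \<in> B"
      unfolding B_def using bl by (intro image_eqI[of _ _ "Blinfun \<phi>"]) (auto simp: bounded_linear_Blinfun_apply)
  qed
  have "compactin (product_topology (\<lambda>_. euclidean) UNIV) K"
    unfolding K_def compactin_PiE by auto
  then have "compact K" by (simp add: euclidean_product_topology)
  moreover have "closed (\<Inter>x::'a. \<Inter>y. {\<phi> :: 'a \<Rightarrow> real. \<phi> (x + y) = \<phi> x + \<phi> y})"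
    by (intro closed_INT ballI closed_Collect_eq continuous_intros continuous_on_product_coordinates)
  moreover have "closed (\<Inter>r. \<Inter>x::'a. {\<phi> :: 'a \<Rightarrow> real. \<phi> (r *\<^sub>R x) = r * \<phi> x})"
    by (intro closed_INT ballI closed_Collect_eq continuous_intros continuous_on_product_coordinates)
  ultimately have "compact B"
    unfolding B_eq by (intro compact_Int_closed)
  \<comment> \<open>A function in \<open>B\<close> is read back as a functional before
    \<open>V\<close> is applied. By \<open>range\<close>, every \<open>\<Phi> (h \<phi>)\<close> is
    evaluation of \<phi> at a point, hence continuous.\<close>
  define h where "h \<phi> = V (Blinfun \<phi>)" for \<phi>
  have "continuous_on B (\<lambda>\<phi>. \<lambda>\<Phi> :: ('a \<Rightarrow>\<^sub>L real) \<Rightarrow>\<^sub>L real. \<Phi> (h \<phi>))"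
  proof (intro continuous_on_coordinatewise_then_product)
    fix \<Phi> :: "('a \<Rightarrow>\<^sub>L real) \<Rightarrow>\<^sub>L real"
    obtain z where z: "\<And>f. \<Phi> (f o\<^sub>L U) = f z" using range by blast
    have "\<Phi> (h \<phi>) = \<phi> z" if "\<phi> \<in> B" for \<phi>
      using that by (auto simp: h_def B_def V z blinfun_apply_inverse)
    moreover have "continuous_on B (\<lambda>\<phi>. \<phi> z)"
      by (rule continuous_on_product_coordinates[THEN continuous_on_subset]) simp
    ultimately show "continuous_on B (\<lambda>\<phi>. \<Phi> (h \<phi>))"
      by (simp cong: continuous_on_cong)
  qed
  then have "continuous_map (subtopology euclidean B) weak_topology h"
    unfolding weak_topology_def
    by (intro continuous_map_pullback') (auto simp: o_def)
  moreover have "compactin (subtopology euclidean B) B"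
    using \<open>compact B\<close> by (simp add: compactin_subtopology)
  ultimately have "compactin weak_topology (h ` B)"
    by (rule image_compactin[rotated])
  moreover have "h ` B = V ` cball 0 1"
    by (simp add: B_def h_def image_image blinfun_apply_inverse)
  ultimately have c: "compactin weak_topology (V ` cball 0 1)" by simp
  \<comment> \<open>In a Hausdorff topology the compact image is closed, so taking its closure adds
    nothing. Evaluations at points separate the functionals.\<close>
  have "Hausdorff_space (weak_topology :: ('a \<Rightarrow>\<^sub>L real) topology)"
  proof (rule Hausdorff_space_injective_preimage)
    show "Hausdorff_space (euclidean :: ((('a \<Rightarrow>\<^sub>L real) \<Rightarrow>\<^sub>L real) \<Rightarrow> real) topology)"
      by (simp add: Hausdorff_space_product_topology flip: euclidean_product_topology)
    show "continuous_map weak_topology euclidean (\<lambda>x. \<lambda>f :: ('a \<Rightarrow>\<^sub>L real) \<Rightarrow>\<^sub>L real. blinfun_apply f x)"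
      using continuous_map_pullback[of euclidean euclidean id UNIV
          "\<lambda>x. \<lambda>f :: ('a \<Rightarrow>\<^sub>L real) \<Rightarrow>\<^sub>L real. blinfun_apply f x"]
      by (simp add: weak_topology_def)
    show "inj_on (\<lambda>x. \<lambda>f :: ('a \<Rightarrow>\<^sub>L real) \<Rightarrow>\<^sub>L real. blinfun_apply f x) (topspace weak_topology)"
    proof (rule inj_onI)
      fix f g :: "'a \<Rightarrow>\<^sub>L real"
      assume eq: "(\<lambda>\<Phi> :: ('a \<Rightarrow>\<^sub>L real) \<Rightarrow>\<^sub>L real. \<Phi> f) = (\<lambda>\<Phi>. \<Phi> g)"
      show "f = g"
      proof (rule blinfun_eqI)
        fix x
        have "blinfun_apply (Blinfun (\<lambda>f. blinfun_apply f x)) f = blinfun_apply (Blinfun (\<lambda>f. blinfun_apply f x)) g"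
          using fun_cong[OF eq] by blast
        then show "f x = g x"
          by (simp add: bounded_linear_Blinfun_apply blinfun.bounded_linear_left)
      qed
    qed
  qed
  then have "closedin weak_topology (V ` cball 0 1)"
    by (rule compactin_imp_closedin[OF _ c])
  then show ?thesis
    using c by (simp add: weakly_compact_operators_def closure_of_closedin)
qed

section \<open>The biadjoint and interpolation\<close>

lemma sum_mult_le_L2_set: "(\<Sum>j\<in>A. a j * b j) \<le> L2_set a A * L2_set b A"
  by (rule order_trans[OF sum_mono L2_set_mult_ineq]) (simp flip: abs_mult)

text \<open>Duality for the Euclidean norm with \<open>a\<close> as its own test vector, for use
  where a sum of squares is first estimated as a pairing.\<close>

lemma L2_set_le_of_dual:
  assumes "(\<Sum>j\<in>A. (a j)\<^sup>2) \<le> L2_set a A * c" "0 \<le> c"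
  shows "L2_set a A \<le> c"
proof (cases "L2_set a A = 0")
  case False
  have "L2_set a A * L2_set a A = (\<Sum>j\<in>A. (a j)\<^sup>2)"
    by (simp add: L2_set_def sum_nonneg)
  then have "L2_set a A * L2_set a A \<le> L2_set a A * c"
    using assms(1) by simp
  moreover have "0 < L2_set a A"
    using False L2_set_nonneg[of a A] by linarith
  ultimately show ?thesis by simp
qed (use assms(2) in simp)

text \<open>The sequence consists of the coordinates of the biadjoint of \<open>U\<close> at \<Phi>.
  Weighting coordinate differences by its own increments gives a functional \<open>g\<close>, whose
  norm Cauchy-Schwarz bounds by the Euclidean norm of these increments.\<close>

lemma bdd_james_variations_bidual:
  fixes \<Phi> :: "(james \<Rightarrow>\<^sub>L real) \<Rightarrow>\<^sub>L real"
  shows "bdd_above (james_variations (\<lambda>n. \<Phi> (james_coord n o\<^sub>L U)))"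
proof (rule james_leI(1)[of "norm \<Phi> * norm U"])
  fix n and p :: "nat \<Rightarrow> nat" assume p: "strict_mono_on {..n} p"
  define a where "a j = \<Phi> (james_coord (p (Suc j)) o\<^sub>L U) - \<Phi> (james_coord (p j) o\<^sub>L U)" for j
  define g where "g = (\<Sum>j<n. a j *\<^sub>R (james_coord (p (Suc j)) - james_coord (p j)))"
  have g: "norm g \<le> L2_set a {..<n}"
  proof (rule norm_blinfun_bound)
    fix x
    let ?d = "\<lambda>j. james_seq x (p (Suc j)) - james_seq x (p j)"
    have "norm (g x) = \<bar>\<Sum>j<n. a j * ?d j\<bar>"
      by (simp add: g_def blinfun.sum_left blinfun.scaleR_left blinfun.diff_left)
    also have "\<dots> \<le> (\<Sum>j<n. \<bar>a j\<bar> * \<bar>?d j\<bar>)"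
      by (rule order_trans[OF sum_abs]) (simp add: abs_mult)
    also have "\<dots> \<le> L2_set a {..<n} * L2_set ?d {..<n}"
      by (rule L2_set_mult_ineq)
    also have "\<dots> \<le> L2_set a {..<n} * norm x"
      using james_L2_le[OF bdd_james_seq p, of x] by (intro mult_left_mono) (simp_all add: norm_james.rep_eq)
    finally show "norm (g x) \<le> L2_set a {..<n} * norm x" .
  qed simp
  have "(\<Sum>j<n. (a j)\<^sup>2) = \<Phi> (g o\<^sub>L U)"
  proof -
    have "g o\<^sub>L U = (\<Sum>j<n. a j *\<^sub>R ((james_coord (p (Suc j)) o\<^sub>L U) - (james_coord (p j) o\<^sub>L U)))"
      by (rule blinfun_eqI) (simp add: g_def blinfun.sum_left blinfun.scaleR_left blinfun.diff_left)
    then show ?thesis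
      by (simp add: blinfun.sum_right blinfun.scaleR_right blinfun.diff_right a_def power2_eq_square)
  qed
  also have "\<dots> \<le> norm \<Phi> * norm (g o\<^sub>L U)"
    using norm_blinfun[of \<Phi> "g o\<^sub>L U"] by simp
  also have "\<dots> \<le> norm \<Phi> * (norm g * norm U)"
    by (intro mult_left_mono norm_blinfun_compose) simp
  also have "\<dots> \<le> norm \<Phi> * (L2_set a {..<n} * norm U)"
    by (intro mult_left_mono mult_right_mono g) simp_all
  finally show "L2_set (\<lambda>j. \<Phi> (james_coord (p (Suc j)) o\<^sub>L U) - \<Phi> (james_coord (p j) o\<^sub>L U)) {..<n}
      \<le> norm \<Phi> * norm U"
    unfolding a_def[symmetric] by (intro L2_set_le_of_dual) (simp_all add: algebra_simps)
qed simp

text \<open>The coordinates of the biadjoint at \<Phi> have bounded variation and vanish at the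
  nodes, so they form an element \<open>z\<close> of \<open>J\<close>. It represents the biadjoint
  against every \<open>f\<close> because the coordinate expansion of \<open>f o\<^sub>L U\<close>
  converges in norm, the basis being shrinking.\<close>

lemma bidual_range:
  fixes k :: "nat \<Rightarrow> nat" and U :: "james \<Rightarrow>\<^sub>L james" and \<Phi> :: "(james \<Rightarrow>\<^sub>L real) \<Rightarrow>\<^sub>L real"
  assumes k: "strict_mono k" and U: "\<And>x i. james_seq (U x) (k i) = 0"
  shows "\<exists>z. \<forall>f. \<Phi> (f o\<^sub>L U) = f z"
proof -
  define \<psi> where "\<psi> = (\<lambda>n. \<Phi> (james_coord n o\<^sub>L U))"
  have "james_coord (k i) o\<^sub>L U = 0" for i
    by (rule blinfun_eqI) (simp add: U)
  then have "\<psi> (k i) = 0" for i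
    by (simp add: \<psi>_def)
  then have "\<psi> \<in> james_seqs"
    using bdd_james_variations_bidual[of \<Phi> U] by (intro james_seqsI_subseq[where k = k] k) (simp_all add: \<psi>_def)
  then obtain z where z: "james_seq z = \<psi>"
    using Abs_james_inverse by blast
  have "\<Phi> (f o\<^sub>L U) = f z" for f :: "james \<Rightarrow>\<^sub>L real"
  proof (rule LIMSEQ_unique)
    define g where "g N = (\<Sum>n<N. f (james_unit n) *\<^sub>R (james_coord n o\<^sub>L U))" for N
    have gx: "g N x = f (james_trunc N (U x))" for N x
      by (simp add: g_def blinfun.sum_left blinfun.scaleR_left james_trunc_def blinfun.sum_right
          blinfun.scaleR_right mult.commute)
    have "g \<longlonglongrightarrow> (f o\<^sub>L U)"
    proof (rule LIMSEQ_I)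
      fix e :: real assume e: "e > 0"
      \<comment> \<open>Adding 1 to \<open>norm U\<close> keeps the denominator positive. The factor
        4 leaves \<open>e/2\<close> after the factor 2 from the norm of tails.\<close>
      define d where "d = e / (4 * (norm U + 1))"
      have d: "d > 0" using e by (simp add: d_def add_nonneg_pos)
      have "e / (4 * c) * c = e / 4" if "c > 0" for c
        using that by simp
      from this[of "norm U + 1"] have dU: "d * (norm U + 1) = e / 4"
        unfolding d_def by (simp only: add_nonneg_pos norm_ge_zero zero_less_one)
      obtain N where N: "\<And>x. (\<forall>n<N. james_seq x n = 0) \<Longrightarrow> \<bar>f x\<bar> \<le> d * norm x"
        using james_functional_small_on_tails[OF d, of f] by blast
      have "norm (g M - (f o\<^sub>L U)) < e" if "N \<le> M" for M
      proof -
        have "norm (g M - (f o\<^sub>L U)) \<le> e/2"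
        proof (rule norm_blinfun_bound)
          fix x
          have "norm ((g M - (f o\<^sub>L U)) x) = \<bar>f (james_tail M (U x))\<bar>"
            by (simp add: blinfun.diff_left gx james_trunc_eq blinfun.diff_right)
          also have "\<dots> \<le> d * norm (james_tail M (U x))"
            using that by (intro N) simp
          also have "\<dots> \<le> d * (2 * norm (U x))"
            using d by (intro mult_left_mono norm_james_tail_le) simp
          also have "\<dots> \<le> d * (2 * (norm U * norm x))"
            using d by (intro mult_left_mono norm_blinfun) simp_all
          also have "\<dots> \<le> d * (2 * ((norm U + 1) * norm x))"
            using d by (intro mult_left_mono mult_right_mono) simp_all
          also have "\<dots> = 2 * (d * (norm U + 1)) * norm x"
            by (simp add: algebra_simps)
          also have "\<dots> = e/2 * norm x"
            by (simp add: dU)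
          finally show "norm ((g M - (f o\<^sub>L U)) x) \<le> e/2 * norm x" .
        qed (use e in simp)
        then show ?thesis using e by linarith
      qed
      then show "\<exists>N. \<forall>M\<ge>N. norm (g M - (f o\<^sub>L U)) < e" by blast
    qed
    then show "(\<lambda>N. \<Phi> (g N)) \<longlonglongrightarrow> \<Phi> (f o\<^sub>L U)"
      by (intro blinfun.tendsto tendsto_const)
    have "\<Phi> (g N) = f (james_trunc N z)" for N
      by (simp add: g_def blinfun.sum_right blinfun.scaleR_right james_trunc_def z \<psi>_def mult.commute)
    then show "(\<lambda>N. \<Phi> (g N)) \<longlonglongrightarrow> f z"
      by (simp add: blinfun.tendsto[OF tendsto_const james_trunc_tendsto])
  qed
  then show ?thesis by blast
qed

section \<open>Monotone interpolation between nodes\<close>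

lemma james_operator:
  fixes F :: "(nat \<Rightarrow> real) \<Rightarrow> nat \<Rightarrow> real"
  assumes F: "\<And>x. F (james_seq x) \<in> james_seqs" "\<And>x. james_norm (F (james_seq x)) \<le> K * norm x"
    and lin: "\<And>x y n. F (\<lambda>n. x n + y n) n = F x n + F y n" "\<And>r x n. F (\<lambda>n. r * x n) n = r * F x n"
  shows "\<exists>Q :: james \<Rightarrow>\<^sub>L james. (\<forall>x. norm (Q x) \<le> K * norm x) \<and> (\<forall>x n. james_seq (Q x) n = F (james_seq x) n)"
proof -
  define q where "q x = Abs_james (F (james_seq x))" for x
  have q: "james_seq (q x) = F (james_seq x)" for x
    using F(1) by (simp add: q_def Abs_james_inverse)
  have n: "norm (q x) \<le> K * norm x" for x
    using F(2) by (simp add: norm_james.rep_eq q)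
  have "bounded_linear q"
  proof (rule bounded_linear_intro)
    show "q (x + y) = q x + q y" for x y
      by (rule james_eqI) (simp add: q plus_james.rep_eq lin)
    show "q (r *\<^sub>R x) = r *\<^sub>R q x" for r x
      by (rule james_eqI) (simp add: q scaleR_james.rep_eq lin)
    show "norm (q x) \<le> norm x * K" for x
      using n by (simp add: mult.commute)
  qed
  then show ?thesis
    using q n by (intro exI[of _ "Blinfun q"]) (simp add: bounded_linear_Blinfun_apply)
qed

text \<open>Each plateau includes its own node and each support ends before the next node. Hence at
  any position all descents but at most one take the value 0 or 1.\<close>

locale james_nodes =
  fixes k :: "nat \<Rightarrow> nat" and t :: "nat \<Rightarrow> james"
  assumes strict_mono_k: "strict_mono k"
    and t_descents: "t i \<in> descents (k i)"
    and t_vanishes: "k (Suc i) \<le> n \<Longrightarrow> james_seq (t i) n = 0"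
begin

text \<open>The default 0 stands for a descent before the first one. With it the weights telescope:
  those with index up to \<open>m\<close> add up to \<open>t m\<close>.\<close>

definition lower :: "nat \<Rightarrow> nat \<Rightarrow> real" where
  "lower i n = (case i of 0 \<Rightarrow> 0 | Suc j \<Rightarrow> james_seq (t j) n)"

definition weight :: "nat \<Rightarrow> nat \<Rightarrow> real" where
  "weight i n = james_seq (t i) n - lower i n"

text \<open>Formally the sum is over all nodes. Weights with index above \<open>n\<close> vanish at
  position \<open>n\<close>, so the cutoff keeps it finite without changing it.\<close>

definition interpolation :: "(nat \<Rightarrow> real) \<Rightarrow> nat \<Rightarrow> real" where
  "interpolation x n = (\<Sum>i\<le>n. weight i n * x (k i))"

lemma t_eq_1: "n \<le> k i \<Longrightarrow> james_seq (t i) n = 1"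
  using t_descents[of i] by (simp add: descents_def)

lemma t_antimono: "m \<le> n \<Longrightarrow> james_seq (t i) n \<le> james_seq (t i) m"
  using t_descents[of i] by (simp add: descents_def antimono_def)

lemma t_range: "0 \<le> james_seq (t i) n" "james_seq (t i) n \<le> 1"
  using t_antimono[of n "max n (k (Suc i))" i] t_vanishes[of i "max n (k (Suc i))"]
    t_antimono[of 0 n i] t_eq_1[of 0 i] by simp_all

text \<open>Where \<open>t (Suc j)\<close> has dropped below 1, the support of \<open>t j\<close>
  has already ended.\<close>

lemma t_mono: "i \<le> j \<Longrightarrow> james_seq (t i) n \<le> james_seq (t j) n"
proof (induction j rule: dec_induct)
  case (step j)
  have "james_seq (t j) n \<le> james_seq (t (Suc j)) n"
    using t_eq_1[of n "Suc j"] t_vanishes[of j n] t_range[of j n] t_range[of "Suc j" n]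
    by (cases "n \<le> k (Suc j)") simp_all
  then show ?case using step by linarith
qed simp

lemma t_self: "n \<le> i \<Longrightarrow> james_seq (t i) n = 1"
  using strict_mono_imp_increasing[OF strict_mono_k, of i] by (intro t_eq_1) simp

lemma lower_le: "lower i n \<le> james_seq (t i) n"
  using t_range[of i n] t_mono[of "i - 1" i n] by (auto simp: lower_def split: nat.split)

lemma weight_eq_0: "n < i \<Longrightarrow> weight i n = 0"
  using t_self[of n i] t_self[of n "i - 1"] by (auto simp: weight_def lower_def split: nat.split)

lemma interpolation_eq:
  assumes "n \<le> m"
  shows "interpolation x n = (\<Sum>i\<le>m. weight i n * x (k i))"
  unfolding interpolation_def using assms
  by (intro sum.mono_neutral_left) (auto simp: weight_eq_0)

lemma weight_node: "weight j (k i) = (if j = i then 1 else 0)"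
proof -
  have km: "a \<le> b \<Longrightarrow> k a \<le> k b" for a b
    using strict_mono_k by (simp add: strict_mono_leD)
  consider "j < i" | "j = i" | "i < j" by linarith
  then show ?thesis
  proof cases
    case 1
    then show ?thesis
      using t_vanishes[of j "k i"] t_vanishes[of "j - 1" "k i"] km[of "Suc j" i] km[of j i]
      by (auto simp: weight_def lower_def split: nat.split)
  next
    case 2
    then show ?thesis
      using t_eq_1[of "k i" i] t_vanishes[of "i - 1" "k i"]
      by (auto simp: weight_def lower_def split: nat.split)
  next
    case 3
    then show ?thesis
      using t_eq_1[of "k i" j] t_eq_1[of "k i" "j - 1"] km[of i j] km[of i "j - 1"]
      by (auto simp: weight_def lower_def split: nat.split)
  qed
qed

lemma interpolation_node: "interpolation x (k i) = x (k i)"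
  using strict_mono_imp_increasing[OF strict_mono_k, of i]
  by (simp add: interpolation_def weight_node if_distrib[of "\<lambda>z. z * _"] cong: if_cong)

text \<open>For fixed \<open>n\<close> these half-open intervals partition \<open>{0..<1}\<close>,
  and their lengths are the weights.\<close>

definition slice :: "nat \<Rightarrow> nat \<Rightarrow> real \<Rightarrow> real" where
  "slice i n = indicator {lower i n..<james_seq (t i) n}"

lemma has_integral_slice: "has_bochner_integral lborel (slice i n) (weight i n)"
  using has_bochner_integral_real_indicator[of "{lower i n..<james_seq (t i) n}" lborel] lower_le[of i n]
  by (simp add: slice_def weight_def)

text \<open>For \<theta> in \<open>{0..<1}\<close> this is the index of the slice containing
  \<theta> at position \<open>n\<close>.\<close>

definition quantile :: "real \<Rightarrow> nat \<Rightarrow> nat" where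
  "quantile \<theta> n = (LEAST i. \<theta> < james_seq (t i) n)"

lemma quantile_less: "\<theta> < 1 \<Longrightarrow> \<theta> < james_seq (t (quantile \<theta> n)) n"
  and quantile_le: "\<theta> < 1 \<Longrightarrow> quantile \<theta> n \<le> n"
  unfolding quantile_def using t_self[of n n]
  by (auto intro: LeastI[of "\<lambda>i. \<theta> < james_seq (t i) n" n] Least_le)

text \<open>Each \<open>t i\<close> descends, so one that exceeds \<theta> at \<open>n\<close>
  already does so at \<open>m\<close>.\<close>

lemma quantile_mono: "\<theta> < 1 \<Longrightarrow> m \<le> n \<Longrightarrow> quantile \<theta> m \<le> quantile \<theta> n"
  using quantile_less[of \<theta> n] t_antimono[of m n "quantile \<theta> n"]
  unfolding quantile_def[of \<theta> m] by (intro Least_le) linarith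

lemma slice_quantile:
  assumes "0 \<le> \<theta>" "\<theta> < 1"
  shows "slice i n \<theta> = (if i = quantile \<theta> n then 1 else 0)"
proof -
  have 1: "\<theta> < james_seq (t j) n \<longleftrightarrow> quantile \<theta> n \<le> j" for j
    using quantile_less[OF assms(2), of n] t_mono[of "quantile \<theta> n" j n]
    by (auto simp: quantile_def intro: Least_le)
  have "lower i n \<le> \<theta> \<longleftrightarrow> i \<le> quantile \<theta> n"
  proof (cases i)
    case (Suc j)
    show ?thesis
      using 1[of j] by (simp add: Suc lower_def) linarith
  qed (use assms(1) in \<open>simp add: lower_def\<close>)
  then show ?thesis
    using 1[of i] by (auto simp: slice_def indicator_def)
qed

lemma slice_eq_0: "\<not> (0 \<le> \<theta> \<and> \<theta> < 1) \<Longrightarrow> slice i n \<theta> = 0"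
  using t_range[of i n] t_range[of "i - 1" n]
  by (auto simp: slice_def lower_def indicator_def split: nat.splits)

text \<open>
  The interpolation is the average over \<open>\<theta> \<in> [0, 1)\<close> of the monotone reparametrizations
  \<open>n \<mapsto> x (k (quantile \<theta> n))\<close>, whose variations are all bounded by those of \<open>x\<close>.
\<close>

lemma interpolation_variation:
  assumes p: "strict_mono_on {..n} (p :: nat \<Rightarrow> nat)"
  shows "L2_set (\<lambda>j. interpolation (james_seq x) (p (Suc j)) - interpolation (james_seq x) (p j)) {..<n}
    \<le> norm x"
proof -
  define m where "m = p n"
  have pm: "p j \<le> m" if "j \<le> n" for j
    using strict_mono_on_leD[OF p, of j n] that by (simp add: m_def)
  define a where "a j = interpolation (james_seq x) (p (Suc j)) - interpolation (james_seq x) (p j)" for j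
  \<comment> \<open>\<open>G\<close> pairs the increments \<open>a\<close> with those of the
    reparametrized sequence at level \<theta>. Its integral is the sum of squares of
    \<open>a\<close>, so a pointwise Cauchy-Schwarz bound suffices.\<close>
  define G where "G \<theta> = (\<Sum>j<n. a j * (\<Sum>i\<le>m. slice i (p (Suc j)) \<theta> * james_seq x (k i)
      - slice i (p j) \<theta> * james_seq x (k i)))" for \<theta>
  have "has_bochner_integral lborel G
      (\<Sum>j<n. a j * (\<Sum>i\<le>m. weight i (p (Suc j)) * james_seq x (k i) - weight i (p j) * james_seq x (k i)))"
    unfolding G_def
    by (intro has_bochner_integral_sum has_bochner_integral_mult_right has_bochner_integral_diff
        has_bochner_integral_mult_left has_integral_slice)
  moreover have "(\<Sum>i\<le>m. weight i (p (Suc j)) * james_seq x (k i) - weight i (p j) * james_seq x (k i)) = a j"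
    if "j < n" for j
    using that pm[of j] pm[of "Suc j"] by (simp add: a_def interpolation_eq[of _ m] sum_subtractf)
  ultimately have G: "has_bochner_integral lborel G (\<Sum>j<n. (a j)\<^sup>2)"
    by (simp add: power2_eq_square)
  let ?C = "L2_set a {..<n} * norm x"
  have "G \<theta> \<le> indicator {0..<1} \<theta> * ?C" for \<theta>
  proof (cases "0 \<le> \<theta> \<and> \<theta> < 1")
    case True
    let ?q = "\<lambda>j. k (quantile \<theta> (p j))"
    have "(\<Sum>i\<le>m. slice i l \<theta> * james_seq x (k i)) = james_seq x (k (quantile \<theta> l))" if "l \<le> m" for l
      using that quantile_le[of \<theta> l] True
      by (simp add: slice_quantile if_distrib[of "\<lambda>z. z * _"] cong: if_cong)
    then have "G \<theta> = (\<Sum>j<n. a j * (james_seq x (?q (Suc j)) - james_seq x (?q j)))"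
      unfolding G_def using pm by (intro sum.cong) (simp_all add: sum_subtractf)
    also have "\<dots> \<le> L2_set a {..<n} * L2_set (\<lambda>j. james_seq x (?q (Suc j)) - james_seq x (?q j)) {..<n}"
      by (rule sum_mult_le_L2_set)
    also have "\<dots> \<le> ?C"
    proof (rule mult_left_mono)
      \<comment> \<open>The selected nodes may repeat, which sorted lists permit.\<close>
      have "?q i \<le> ?q j" if "i \<le> j" "j \<le> n" for i j
        using that strict_mono_on_leD[OF p, of i j] True
        by (intro strict_mono_leD[OF strict_mono_k] quantile_mono) auto
      then have "sorted (map ?q [0..<Suc n])"
        unfolding sorted_iff_nth_mono by (auto simp del: upt_Suc)
      from sq_var_james_le[OF this, of x]
      show "L2_set (\<lambda>j. james_seq x (?q (Suc j)) - james_seq x (?q j)) {..<n} \<le> norm x"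
        unfolding sq_var_map_upt L2_set_def by (simp add: real_le_lsqrt)
    qed simp
    finally show ?thesis using True by simp
  next
    case False
    then show ?thesis by (simp add: G_def slice_eq_0)
  qed
  moreover have C: "has_bochner_integral lborel (\<lambda>\<theta>. indicator {0..<1::real} \<theta> * ?C) (1 * ?C)"
    using has_bochner_integral_real_indicator[of "{0..<1::real}" lborel]
    by (intro has_bochner_integral_mult_left) simp
  ultimately have "integral\<^sup>L lborel G \<le> (\<integral>\<theta>. indicator {0..<1::real} \<theta> * ?C \<partial>lborel)"
    using G by (intro integral_mono) (auto simp: has_bochner_integral_iff)
  then have "(\<Sum>j<n. (a j)\<^sup>2) \<le> ?C"
    using G C by (simp add: has_bochner_integral_iff)
  then show ?thesis
    unfolding a_def[symmetric] by (intro L2_set_le_of_dual) simp_all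
qed

lemma interpolation_james:
  "interpolation (james_seq x) \<in> james_seqs" "james_norm (interpolation (james_seq x)) \<le> norm x"
proof -
  have "(\<lambda>i. interpolation (james_seq x) (k i)) \<longlonglongrightarrow> 0"
    using LIMSEQ_subseq_LIMSEQ[OF tendsto_james_seq[of x] strict_mono_k]
    by (simp add: interpolation_node o_def)
  then show "interpolation (james_seq x) \<in> james_seqs"
    using james_leI(1)[OF norm_ge_zero[of x] interpolation_variation]
    by (intro james_seqsI_subseq[where k = k] strict_mono_k)
  show "james_norm (interpolation (james_seq x)) \<le> norm x"
    using james_leI(2)[OF norm_ge_zero[of x] interpolation_variation] .
qed

text \<open>With the contribution of \<open>k 0\<close> removed, the interpolation is a series in
  the differences \<open>t (Suc i) - t i\<close>, on which \<open>f\<close> is summably small. The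
  bound 3 counts the identity, the interpolation and the rank-one correction once each.\<close>

lemma interpolation_remainder:
  "\<exists>U :: james \<Rightarrow>\<^sub>L james. norm U \<le> 3 \<and> (\<forall>x i. james_seq (blinfun_apply U x) (k (Suc i)) = 0) \<and>
     (\<forall>(f :: james \<Rightarrow>\<^sub>L real) \<delta>.
       (\<forall>i. \<bar>blinfun_apply f (t (Suc i)) - blinfun_apply f (t i)\<bar> \<le> \<delta> * (1/2) ^ Suc i) \<longrightarrow> norm (f - (f o\<^sub>L U)) \<le> \<delta>)"
proof -
  obtain Q :: "james \<Rightarrow>\<^sub>L james" where Q: "\<And>x. norm (Q x) \<le> 1 * norm x"
    "\<And>x n. james_seq (Q x) n = interpolation (james_seq x) n"
    using james_operator[of interpolation 1] interpolation_james
    by (auto simp: interpolation_def algebra_simps sum.distrib sum_distrib_left)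
  \<comment> \<open>The weight of node \<open>k 0\<close> is all of \<open>t 0\<close>, where
    \<open>f\<close> need not be small. Subtracting this term costs the vanishing of
    \<open>U x\<close> at \<open>k 0\<close>.\<close>
  define W where "W = Q - (blinfun_scaleR_left (t 0) o\<^sub>L james_coord (k 0))"
  have W: "W x = Q x - james_seq x (k 0) *\<^sub>R t 0" for x
    by (simp add: W_def blinfun.diff_left blinfun_scaleR_left.rep_eq)
  define U where "U = id_blinfun - W"
  have U: "U x = x - W x" for x
    by (simp add: U_def blinfun.diff_left)
  have "norm U \<le> 3"
  proof (rule norm_blinfun_bound)
    fix x
    have "norm (james_seq x (k 0) *\<^sub>R t 0) \<le> norm x * 1"
      unfolding norm_scaleR by (intro mult_mono norm_descents_le[OF t_descents]) (simp_all add: james_seq_le_norm)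
    moreover have "norm (U x) \<le> norm x + (norm (Q x) + norm (james_seq x (k 0) *\<^sub>R t 0))"
      unfolding U W by (intro order_trans[OF norm_triangle_ineq4] add_mono) simp_all
    ultimately show "norm (U x) \<le> 3 * norm x"
      using Q(1)[of x] by simp
  qed simp
  moreover have "james_seq (U x) (k (Suc i)) = 0" for x i
  proof -
    have "k (Suc 0) \<le> k (Suc i)" using strict_mono_k by (simp add: strict_mono_leD)
    then show ?thesis
      by (simp add: U W Q(2) interpolation_node t_vanishes[of 0])
  qed
  moreover have "norm (f - (f o\<^sub>L U)) \<le> \<delta>"
    if f: "\<And>i. \<bar>f (t (Suc i)) - f (t i)\<bar> \<le> \<delta> * (1/2) ^ Suc i" for f :: "james \<Rightarrow>\<^sub>L real" and \<delta>
  proof (rule norm_blinfun_bound)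
    show d: "0 \<le> \<delta>" using order_trans[OF abs_ge_zero f[of 0]] by simp
    fix x
    have "\<bar>f (W (james_trunc (k (Suc m)) x))\<bar> \<le> \<delta> * norm x" for m
    proof -
      \<comment> \<open>The truncation keeps exactly the nodes \<open>k i\<close> with
        \<open>i \<le> m\<close>, so \<open>W y\<close> is a finite sum. The bound passes to
        \<open>x\<close> in the limit.\<close>
      define y where "y = james_trunc (k (Suc m)) x"
      have yk: "james_seq y (k i) = (if i \<le> m then james_seq x (k i) else 0)" for i
        using strict_mono_less[OF strict_mono_k, of i "Suc m"] by (simp add: y_def less_Suc_eq_le)
      have "W y = (\<Sum>i<m. james_seq x (k (Suc i)) *\<^sub>R (t (Suc i) - t i))"
      proof (rule james_eqI)
        fix n
        have "interpolation (james_seq y) n = (\<Sum>i\<le>max n m. weight i n * james_seq y (k i))"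
          by (rule interpolation_eq) simp
        also have "\<dots> = (\<Sum>i\<le>m. weight i n * james_seq x (k i))"
          by (rule sum.mono_neutral_cong_right) (auto simp: yk)
        also have "\<dots> = weight 0 n * james_seq x (k 0) + (\<Sum>i<m. weight (Suc i) n * james_seq x (k (Suc i)))"
          by (rule sum.atMost_shift)
        finally show "james_seq (W y) n = james_seq (\<Sum>i<m. james_seq x (k (Suc i)) *\<^sub>R (t (Suc i) - t i)) n"
          by (simp add: W Q(2) yk weight_def lower_def mult.commute)
      qed
      then have "\<bar>f (W y)\<bar> = \<bar>\<Sum>i<m. james_seq x (k (Suc i)) * (f (t (Suc i)) - f (t i))\<bar>"
        by (simp add: blinfun.sum_right blinfun.scaleR_right blinfun.diff_right)
      also have "\<dots> \<le> (\<Sum>i<m. norm x * (\<delta> * (1/2) ^ Suc i))"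
        by (rule order_trans[OF sum_abs sum_mono])
          (simp only: abs_mult mult_mono james_seq_le_norm f abs_ge_zero norm_ge_zero)
      also have "\<dots> = norm x * \<delta> * (\<Sum>i<m. (1/2) ^ Suc i)"
        by (simp add: sum_distrib_left mult.assoc)
      also have "(\<Sum>i<m. (1/2) ^ Suc i) = 1 - (1/2 :: real) ^ m"
        by (induction m) simp_all
      also have "norm x * \<delta> * (1 - (1/2) ^ m) \<le> norm x * \<delta> * 1"
        using d by (intro mult_left_mono) simp_all
      finally show ?thesis by (simp add: y_def mult.commute)
    qed
    moreover have "(\<lambda>m. james_trunc (k (Suc m)) x) \<longlonglongrightarrow> x"
      using LIMSEQ_Suc[OF LIMSEQ_subseq_LIMSEQ[OF james_trunc_tendsto[of x] strict_mono_k]]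
      by (simp add: o_def)
    then have "(\<lambda>m. \<bar>f (W (james_trunc (k (Suc m)) x))\<bar>) \<longlonglongrightarrow> \<bar>f (W x)\<bar>"
      by (intro tendsto_rabs blinfun.tendsto tendsto_const)
    ultimately have "\<bar>f (W x)\<bar> \<le> \<delta> * norm x"
      by (intro tendsto_upperbound[OF _ _ trivial_limit_sequentially]) auto
    then show "norm ((f - (f o\<^sub>L U)) x) \<le> \<delta> * norm x"
      by (simp add: blinfun.diff_left U blinfun.diff_right)
  qed
  ultimately show ?thesis by blast
qed

end

section \<open>Approximate left units\<close>

lemma uniform_descent:
  fixes F :: "((james \<Rightarrow>\<^sub>L real) \<Rightarrow>\<^sub>L (james \<Rightarrow>\<^sub>L real)) set"
  assumes "finite F" "F \<subseteq> weakly_compact_operators" "e > 0"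
  shows "\<exists>t\<in>descents N. \<forall>T\<in>F. \<forall>g\<in>cball 0 1. \<bar>blinfun_apply (T g) t - james_limit (T g)\<bar> < e"
  using assms(1,2)
proof (induction F arbitrary: N)
  case empty
  then show ?case using james_step_in_descents by blast
next
  case (insert T F)
  \<comment> \<open>The induction hypothesis gives ever later descents that serve \<open>F\<close>.
    Their convex combinations still serve \<open>F\<close>, and weak compactness of \<open>T\<close>
    provides one that serves \<open>T\<close> as well.\<close>
  have "\<forall>n. \<exists>t. t \<in> descents (N + n) \<and> (\<forall>S\<in>F. \<forall>g\<in>cball 0 1. \<bar>blinfun_apply (S g) t - james_limit (S g)\<bar> < e)"
    using insert by blast
  then obtain t where t: "\<And>n. t n \<in> descents (N + n)"
    "\<And>n S g. S \<in> F \<Longrightarrow> g \<in> cball 0 1 \<Longrightarrow> \<bar>blinfun_apply (S g) (t n) - james_limit (S g)\<bar> < e"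
    by metis
  define \<psi> where "\<psi> n = Blinfun (\<lambda>f. blinfun_apply f (t n)) - james_limit" for n
  have \<psi>: "\<psi> n f = f (t n) - james_limit f" for n f
    by (simp add: \<psi>_def blinfun.diff_left bounded_linear_Blinfun_apply blinfun.bounded_linear_left)
  have "(\<lambda>n. \<psi> n f) \<longlonglongrightarrow> 0" for f
  proof (rule LIMSEQ_I)
    fix r :: real assume "r > 0"
    then obtain M where M: "\<And>t. t \<in> descents M \<Longrightarrow> \<bar>f t - james_limit f\<bar> < r"
      using descents_near_limit by blast
    have "t n \<in> descents M" if "M \<le> n" for n
      using t(1)[of n] descents_mono[of M "N + n"] that by auto
    then show "\<exists>M. \<forall>n\<ge>M. norm (\<psi> n f - 0) < r"
      using M by (auto simp: \<psi>)
  qed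
  moreover have "T \<in> weakly_compact_operators" using insert.prems by simp
  ultimately obtain J w where J: "finite J" "\<And>j. j \<in> J \<Longrightarrow> 0 \<le> w j" "sum w J = 1"
    "\<And>g. g \<in> cball 0 1 \<Longrightarrow> \<bar>\<Sum>j\<in>J. w j * \<psi> j (T g)\<bar> < e"
    using weakly_compact_convex_combination[of T \<psi> e] \<open>e > 0\<close> by metis
  define s where "s = (\<Sum>j\<in>J. w j *\<^sub>R t j)"
  have s: "f s - james_limit f = (\<Sum>j\<in>J. w j * \<psi> j f)" for f :: "james \<Rightarrow>\<^sub>L real"
    using J(3) by (simp add: s_def \<psi> blinfun.sum_right blinfun.scaleR_right right_diff_distrib
        sum_subtractf flip: sum_distrib_right)
  have "t j \<in> descents N" for j
    using t(1)[of j] descents_mono[of N "N + j"] by auto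
  then have "s \<in> descents N"
    unfolding s_def using J by (intro convex_sum[OF _ convex_descents]) auto
  moreover have "\<bar>blinfun_apply (S g) s - james_limit (S g)\<bar> < e" if "S \<in> insert T F" "g \<in> cball 0 1" for S g
  proof (cases "S = T")
    case True
    then show ?thesis using J(4)[OF that(2)] by (simp add: s)
  next
    case False
    then have S: "S \<in> F" using that by simp
    \<comment> \<open>One positive weight is enough for the weighted sum to stay strictly below
      \<open>e\<close>.\<close>
    obtain j0 where j0: "j0 \<in> J" "0 < w j0"
      using J(2,3) by (metis less_eq_real_def sum.neutral zero_neq_one)
    have "\<bar>\<Sum>j\<in>J. w j * \<psi> j (S g)\<bar> \<le> (\<Sum>j\<in>J. w j * \<bar>\<psi> j (S g)\<bar>)"
      using J(2) by (intro order_trans[OF sum_abs sum_mono]) (simp add: abs_mult)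
    also have "\<dots> < (\<Sum>j\<in>J. w j * e)"
    proof (rule sum_strict_mono_ex1[OF J(1)])
      show "\<forall>j\<in>J. w j * \<bar>\<psi> j (S g)\<bar> \<le> w j * e"
        using J(2) t(2)[OF S that(2)] by (auto simp: \<psi> intro!: mult_left_mono[OF less_imp_le])
      show "\<exists>j\<in>J. w j * \<bar>\<psi> j (S g)\<bar> < w j * e"
        using j0 t(2)[OF S that(2)] by (intro bexI[of _ j0]) (auto simp: \<psi>)
    qed
    also have "\<dots> = e" using J(3) by (simp flip: sum_distrib_right)
    finally show ?thesis by (simp add: s)
  qed
  ultimately show ?case by blast
qed

lemma norm_blinfun_le_cball:
  fixes A :: "'a::real_normed_vector \<Rightarrow>\<^sub>L 'b::real_normed_vector"
  assumes "\<And>g. g \<in> cball 0 1 \<Longrightarrow> norm (A g) \<le> e"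
  shows "norm A \<le> e"
proof (rule norm_blinfun_bound)
  show "0 \<le> e" using assms[of 0] by simp
  fix x
  show "norm (A x) \<le> e * norm x"
  proof (cases "x = 0")
    case False
    then show ?thesis
      using assms[of "x /\<^sub>R norm x"] by (simp add: blinfun.scaleR_right field_simps)
  qed simp
qed

text \<open>One sequence of descents serves all of \<open>F\<close>. The adjoint \<open>V\<close> of
  the resulting remainder \<open>U\<close> is weakly compact because \<open>U\<close> vanishes at
  nodes, and it nearly fixes each \<open>T g\<close> because \<open>T g\<close> varies little along
  the descents.\<close>

lemma weakly_compact_approximation:
  fixes F :: "((james \<Rightarrow>\<^sub>L real) \<Rightarrow>\<^sub>L (james \<Rightarrow>\<^sub>L real)) set"
  assumes F: "finite F" "F \<subseteq> weakly_compact_operators" and e: "e > 0"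
  shows "\<exists>V\<in>weakly_compact_operators. norm V \<le> 3 \<and> (\<forall>T\<in>F. norm (T - (V o\<^sub>L T)) \<le> e)"
proof -
  \<comment> \<open>Two consecutive tolerances add up to at most \<open>e * (1/2) ^ Suc i\<close>,
    as \<open>interpolation_remainder\<close> requires.\<close>
  define close where "close i t \<longleftrightarrow> (\<forall>T\<in>F. \<forall>g\<in>cball 0 1. \<bar>blinfun_apply (T g) t - james_limit (T g)\<bar> < e/4 * (1/2) ^ i)"
    for i :: nat and t
  have ex: "\<exists>t. t \<in> descents N \<and> close i t" for N i
    using uniform_descent[OF F, of "e/4 * (1/2) ^ i" N] e by (auto simp: close_def)
  have "\<exists>c. \<forall>i. (snd (c i) \<in> descents (fst (c i)) \<and> close i (snd (c i))) \<and>
      (fst (c i) < fst (c (Suc i)) \<and> (\<forall>n\<ge>fst (c (Suc i)). james_seq (snd (c i)) n = 0))"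
  proof (rule dependent_nat_choice)
    show "\<exists>c. snd c \<in> descents (fst c) \<and> close 0 (snd c)"
      using ex[of 0 0] by auto
    fix c :: "nat \<times> james" and i
    assume c: "snd c \<in> descents (fst c) \<and> close i (snd c)"
    then obtain M where M: "\<And>n. n \<ge> M \<Longrightarrow> james_seq (snd c) n = 0"
      by (auto simp: descents_def)
    \<comment> \<open>The next node lies beyond the previous one and beyond the support of the
      previous descent.\<close>
    obtain t where "t \<in> descents (max M (Suc (fst c)))" "close (Suc i) t"
      using ex by blast
    then show "\<exists>d. (snd d \<in> descents (fst d) \<and> close (Suc i) (snd d)) \<and>
        (fst c < fst d \<and> (\<forall>n\<ge>fst d. james_seq (snd c) n = 0))"
      using M by (intro exI[of _ "(max M (Suc (fst c)), t)"]) auto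
  qed
  then obtain c where c: "\<And>i. snd (c i) \<in> descents (fst (c i))" "\<And>i. close i (snd (c i))"
    "\<And>i. fst (c i) < fst (c (Suc i))" "\<And>i n. fst (c (Suc i)) \<le> n \<Longrightarrow> james_seq (snd (c i)) n = 0"
    by blast
  define k where "k i = fst (c i)" for i
  define t where "t i = snd (c i)" for i
  interpret james_nodes k t
    by unfold_locales (use c in \<open>auto simp: k_def t_def strict_mono_Suc_iff\<close>)
  obtain U :: "james \<Rightarrow>\<^sub>L james" where U: "norm U \<le> 3" "\<And>x i. james_seq (U x) (k (Suc i)) = 0"
    "\<And>(f :: james \<Rightarrow>\<^sub>L real) \<delta>.
       (\<And>i. \<bar>blinfun_apply f (t (Suc i)) - blinfun_apply f (t i)\<bar> \<le> \<delta> * (1/2) ^ Suc i) \<Longrightarrow> norm (f - (f o\<^sub>L U)) \<le> \<delta>"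
    using interpolation_remainder by blast
  have bl: "bounded_linear (\<lambda>f :: james \<Rightarrow>\<^sub>L real. f o\<^sub>L U)"
    by (rule bounded_bilinear.bounded_linear_left[OF bounded_bilinear_blinfun_compose])
  define V where "V = Blinfun (\<lambda>f :: james \<Rightarrow>\<^sub>L real. f o\<^sub>L U)"
  have V: "V f = f o\<^sub>L U" for f
    by (simp add: V_def bounded_linear_Blinfun_apply bl)
  \<comment> \<open>The shift skips \<open>k 0\<close>, where \<open>U x\<close> need not
    vanish.\<close>
  have "strict_mono (\<lambda>i. k (Suc i))"
    using strict_mono_k by (simp add: strict_mono_Suc_iff)
  then have "V \<in> weakly_compact_operators"
    using V bidual_range U(2) by (intro weakly_compact_precomposition[of V U]) blast+
  moreover have "norm V \<le> 3"
  proof (rule norm_blinfun_bound)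
    fix f
    have "norm (V f) \<le> norm f * norm U" unfolding V by (rule norm_blinfun_compose)
    also have "\<dots> \<le> norm f * 3" by (intro mult_left_mono U) simp
    finally show "norm (V f) \<le> 3 * norm f" by simp
  qed simp
  moreover have "norm (T - (V o\<^sub>L T)) \<le> e" if "T \<in> F" for T
  proof (rule norm_blinfun_le_cball)
    fix g :: "james \<Rightarrow>\<^sub>L real" assume g: "g \<in> cball 0 1"
    have lim: "\<bar>blinfun_apply (T g) (t i) - james_limit (T g)\<bar> < e/4 * (1/2) ^ i" for i
      using c(2)[of i] that g by (simp add: close_def t_def)
    have "\<bar>blinfun_apply (T g) (t (Suc i)) - blinfun_apply (T g) (t i)\<bar> \<le> e * (1/2) ^ Suc i" for i
    proof -
      have "e/4 * (1/2) ^ Suc i + e/4 * (1/2) ^ i \<le> e * (1/2) ^ Suc i"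
        using e by simp
      then show ?thesis using lim[of i] lim[of "Suc i"] by linarith
    qed
    then have "norm (T g - (T g o\<^sub>L U)) \<le> e" by (rule U(3))
    then show "norm ((T - (V o\<^sub>L T)) g) \<le> e" by (simp add: blinfun.diff_left V)
  qed
  ultimately show ?thesis by blast
qed

text \<open>Finite subsets of \<open>A\<close> paired with a precision index form a directed set.
  Enlarging the subset and the index keeps all earlier approximations, and \<open>C\<close> bounds
  the net.\<close>

lemma has_blai_finite_approximation:
  fixes mul :: "'a::real_normed_vector \<Rightarrow> 'a \<Rightarrow> 'a"
  assumes approx: "\<And>F e. finite F \<Longrightarrow> F \<subseteq> A \<Longrightarrow> e > 0 \<Longrightarrow>
    \<exists>v\<in>A. norm v \<le> C \<and> (\<forall>y\<in>F. norm (y - mul v y) \<le> e)"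
  shows "has_blai mul A"
proof -
  define I where "I = {F. finite F \<and> F \<subseteq> A} \<times> (UNIV :: nat set)"
  define r where "r = {(p, q). p \<in> I \<and> q \<in> I \<and> fst p \<subseteq> fst q \<and> snd p \<le> snd q}"
  have "\<exists>v. v \<in> A \<and> norm v \<le> C \<and> (\<forall>y\<in>fst q. norm (y - mul v y) \<le> inverse (real (Suc (snd q))))"
    if "q \<in> I" for q
    using approx[of "fst q" "inverse (real (Suc (snd q)))"] that by (auto simp: I_def)
  then obtain x where x: "\<And>q. q \<in> I \<Longrightarrow> x q \<in> A" "\<And>q. q \<in> I \<Longrightarrow> norm (x q) \<le> C"
    "\<And>q y. q \<in> I \<Longrightarrow> y \<in> fst q \<Longrightarrow> norm (y - mul (x q) y) \<le> inverse (real (Suc (snd q)))"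
    by metis
  have "is_blai mul A I r x"
    unfolding is_blai_def
  proof (intro conjI ballI allI impI)
    show "I \<noteq> {}" by (auto simp: I_def)
    show "preorder_on I r"
      unfolding preorder_on_def r_def refl_on_def trans_def by auto
    show "\<exists>k\<in>I. (i, k) \<in> r \<and> (j, k) \<in> r" if "i \<in> I" "j \<in> I" for i j
      using that
      by (intro bexI[of _ "(fst i \<union> fst j, max (snd i) (snd j))"]) (auto simp: r_def I_def)
    show "x ` I \<subseteq> A" using x(1) by blast
    show "bounded (x ` I)" using x(2) unfolding bounded_iff by blast
    fix y and \<epsilon> :: real assume y: "y \<in> A" and "\<epsilon> > 0"
    then obtain n where n: "inverse (real (Suc n)) < \<epsilon>"
      using reals_Archimedean by blast
    show "\<exists>i\<in>I. \<forall>k\<in>I. (i, k) \<in> r \<longrightarrow> norm (y - mul (x k) y) < \<epsilon>"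
    proof (intro bexI[of _ "({y}, n)"] ballI impI)
      fix k assume k: "k \<in> I" "(({y}, n), k) \<in> r"
      then have "norm (y - mul (x k) y) \<le> inverse (real (Suc (snd k)))"
        using x(3)[of k y] by (auto simp: r_def)
      also have "\<dots> \<le> inverse (real (Suc n))"
        using k by (auto simp: r_def intro!: le_imp_inverse_le)
      finally show "norm (y - mul (x k) y) < \<epsilon>" using n by simp
    qed (use y in \<open>simp add: I_def\<close>)
  qed
  then show ?thesis by (rule has_blaiI)
qed

theorem corollary3p5:
  shows "has_blai (o\<^sub>L)
    (weakly_compact_operators :: ((james \<Rightarrow>\<^sub>L real) \<Rightarrow>\<^sub>L (james \<Rightarrow>\<^sub>L real)) set)"
  by (rule has_blai_finite_approximation[where C = 3]) (rule weakly_compact_approximation)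

end
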